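(* Let $K$ be a compact Calderón–Zygmund kernel on $\mathbb R^n$ with parameter $0<\delta<1$ and auxiliary functions $L,S,D$, and let $T$ be a linear operator associated with $K$ which satisfies the weak compactness condition with function $F_W$. Then for all cubes $I,J\subset\mathbb R^n$ and all bump functions $\psi_I,\psi_J$ adapted to and supported on $I,J$ respectively, with constant $C>0$ and order zero, $$ |\langle T(\psi_I),\psi_J\rangle|\lesssim C^2\,\frac{\mathrm{ec}(I,J)^{\frac12}}{\mathrm{rdist}(I,J)^{n}}\,\big(1+|\log \mathrm{ec}(I,J)|^{\theta}\big)\,F(I,J), $$ where (i) $F(I,J)=F_K(\langle I,J\rangle)$ and $\theta=0$ when $\mathrm{rdist}(I,J)>3$; (ii) $F(I,J)=F_W(I\wedge J)+F_K(I\wedge J,\, I\vee J,\, I\vee J)$ and $\theta=1$ when $\mathrm{rdist}(I,J)\le3$. The implicit constant depends only on $T$ and $\delta$.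
   Context: **Cubes.** A cube is $I=\prod_{i=1}^n[a_i,b_i]$ with all $b_i-a_i>0$ equal; $c(I)$ is its centre, $\ell(I)$ its side length, $|I|=\ell(I)^n$. $|\cdot|_\infty$ is the max norm on $\mathbb R^n$, $\mathbb B=[-1/2,1/2]^n$. $\langle I,J\rangle$ is the cube containing $I\cup J$ with smallest possible side length and whose centre has smallest possible first coordinate (any fixed choice if this is not unique); $\mathrm{diam}(I\cup J)=\ell(\langle I,J\rangle)$. Put $$\mathrm{rdist}(I,J)=\frac{\mathrm{diam}(I\cup J)}{\max(\ell(I),\ell(J))},\qquad \mathrm{ec}(I,J)=\frac{\min(|I|,|J|)}{\max(|I|,|J|)}.$$ If $\ell(J)\le\ell(I)$ then $I\wedge J=J$, $I\vee J=I$; otherwise $I\wedge J=I$, $I\vee J=J$. With $\theta=0$ the factor $1+|\log \mathrm{ec}(I,J)|^{\theta}$ is a constant. **Kernel.** $K$ is defined on $\{(t,x)\in\mathbb R^n\times\mathbb R^n: t\ne x\}$ with values in $\mathbb C$. $L,S,D:[0,\infty)\to[0,\infty)$ are bounded, $L,D$ non-increasing, $S$ non-decreasing, with $\lim_{y\to\infty}L(y)=\lim_{y\to0}S(y)=\lim_{y\to\infty}D(y)=0$. That $K$ is a compact Calderón–Zygmund kernel with parameter $\delta$ and functions $L,S,D$ means (this is the working form of the definition): for some constant $C_K>0$, $$|K(t,x)-K(t',x')|\le C_K\frac{(|t-t'|_\infty+|x-x'|_\infty)^{\delta}}{|t-x|_\infty^{n+\delta}}\,L(|t-x|_\infty)\,S(|t-t'|_\infty+|x-x'|_\infty)\,D\Big(1+\frac{|t+x|_\infty}{1+|t-x|_\infty}\Big)$$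 whenever $2(|t-t'|_\infty+|x-x'|_\infty)<|t-x|_\infty$, and $$|K(t,x)|\le C_K\frac{1}{|t-x|_\infty^{n}}\,L(|t-x|_\infty)\,S(|t-x|_\infty)\,D\Big(1+\frac{|t+x|_\infty}{1+|t-x|_\infty}\Big)\quad (t\neq x).$$ **Function $F_K$.** For cubes $I_1,I_2,I_3$, $F_K(I_1,I_2,I_3)=L(\ell(I_1))\,S(\ell(I_2))\,D(\mathrm{rdist}(I_3,\mathbb B))$ and $F_K(I)=F_K(I,I,I)$. **Convention on constants.** Universal constants inside the arguments of $L,S,D$ are omitted: an estimate involving $F_K$ is understood to hold after replacing $L,S,D$ in its definition by $L(\kappa\,\cdot),S(\kappa^{-1}\cdot),D(\kappa\,\cdot)$ for some constant $\kappa\in(0,1]$ depending only on $n$ and $\delta$. **Operator.** $\mathcal C_0(\mathbb R^n)$ denotes the continuous functions with compact support. $T:\mathcal C_0(\mathbb R^n)\to\mathcal C_0(\mathbb R^n)'$ is continuous and linear; the pairing $\langle T(f),g\rangle$ is understood to be defined and bilinear also for bounded measurable compactly supported $f,g$. $T$ is associated with $K$ if $\langle T(f),g\rangle=\iint f(t)g(x)K(x,t)\,dt\,dx$ for all such $f,g$ with disjoint compact supports. **Bump functions** ($L^2$-normalized). Fix a decay exponent $N\in\mathbb N$. A bounded (measurable) $\phi$ is a bump function adapted to $I$ with constant $C$, decay $N$, order zero if $|\phi(x)|\le C|I|^{-1/2}\big(1+\frac{|x-c(I)|_\infty}{\ell(I)}\big)^{-N}$ for all $x$. Bump functions in the claim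 have decay $N$. **Weak compactness condition.** There is a bounded function $F_W$ from cubes to $[0,\infty)$ with $\lim_{\ell(I)\to\infty}F_W(I)=\lim_{\ell(I)\to0}F_W(I)=\lim_{|c(I)|_\infty\to\infty}F_W(I)=0$ such that $|\langle T(\phi_I),\varphi_I\rangle|\lesssim C^2F_W(I)$ for every cube $I$ and all (compactly supported) bump functions $\phi_I,\varphi_I$ adapted to $I$ with constant $C$, decay $N$, order zero, the implicit constant depending only on $T$. *)

theory Defs
  imports "HOL-Analysis.Analysis"
begin

section \<open>Cubes\<close>

definition cube :: "(real^'n) set \<Rightarrow> bool" where
  "cube I \<longleftrightarrow> (\<exists>a b l. 0 < l \<and> (\<forall>i. b $ i - a $ i = l) \<and> I = cbox a b)"

definition center :: "(real^'n) set \<Rightarrow> real^'n" where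
  "center I = midpoint (interval_lowerbound I) (interval_upperbound I)"

definition side :: "(real^'n) set \<Rightarrow> real" where
  "side I = (THE l. \<forall>i. interval_upperbound I $ i - interval_lowerbound I $ i = l)"

definition vol :: "(real^'n) set \<Rightarrow> real" where
  "vol I = side I ^ CARD('n)"

definition unit_cube :: "(real^'n) set" where
  "unit_cube = cbox (\<chi> i. - 1/2) (\<chi> i. 1/2)"

definition min_cubes :: "(real^'n) set \<Rightarrow> (real^'n) set \<Rightarrow> (real^'n) set set" where
  "min_cubes I J = {Q. cube Q \<and> I \<union> J \<subseteq> Q \<and>
     (\<forall>Q'. cube Q' \<and> I \<union> J \<subseteq> Q' \<longrightarrow> side Q \<le> side Q')}"

text \<open>The first coordinate is the one with the least index. The remaining freedom in
  \<open>\<langle>I,J\<rangle>\<close> is resolved by an arbitrary fixed choice.\<close>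

definition joint_cube ::
    "(real^'n::{finite,linorder}) set \<Rightarrow> (real^'n::{finite,linorder}) set \<Rightarrow> (real^'n::{finite,linorder}) set" where
  "joint_cube I J = (SOME Q. Q \<in> min_cubes I J \<and>
     (\<forall>Q' \<in> min_cubes I J. center Q $ Min UNIV \<le> center Q' $ Min UNIV))"

definition rdist :: "(real^'n::{finite,linorder}) set \<Rightarrow> (real^'n::{finite,linorder}) set \<Rightarrow> real" where
  "rdist I J = side (joint_cube I J) / max (side I) (side J)"

definition ec :: "(real^'n) set \<Rightarrow> (real^'n) set \<Rightarrow> real" where
  "ec I J = min (vol I) (vol J) / max (vol I) (vol J)"

definition smaller_cube :: "(real^'n) set \<Rightarrow> (real^'n) set \<Rightarrow> (real^'n) set" where
  "smaller_cube I J = (if side J \<le> side I then J else I)"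

definition larger_cube :: "(real^'n) set \<Rightarrow> (real^'n) set \<Rightarrow> (real^'n) set" where
  "larger_cube I J = (if side J \<le> side I then I else J)"

section \<open>Compact Calderon--Zygmund kernels\<close>

definition aux_functions :: "(real \<Rightarrow> real) \<Rightarrow> (real \<Rightarrow> real) \<Rightarrow> (real \<Rightarrow> real) \<Rightarrow> bool" where
  "aux_functions L S D \<longleftrightarrow>
     L ` {0..} \<subseteq> {0..} \<and> S ` {0..} \<subseteq> {0..} \<and> D ` {0..} \<subseteq> {0..} \<and>
     bounded (L ` {0..}) \<and> bounded (S ` {0..}) \<and> bounded (D ` {0..}) \<and>
     antimono_on {0..} L \<and> mono_on {0..} S \<and> antimono_on {0..} D \<and>
     (L \<longlongrightarrow> 0) at_top \<and> (S \<longlongrightarrow> 0) (at_right 0) \<and> (D \<longlongrightarrow> 0) at_top"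

text \<open>The constant \<open>C\<^sub>K\<close> of the kernel estimates is an explicit argument, since bounds for
  operators with kernel \<open>K\<close> depend on it. The values of \<open>K\<close> on the diagonal play no role.\<close>

definition compact_CZ_kernel ::
    "real \<Rightarrow> real \<Rightarrow> (real \<Rightarrow> real) \<Rightarrow> (real \<Rightarrow> real) \<Rightarrow> (real \<Rightarrow> real)
     \<Rightarrow> (real^'n \<Rightarrow> real^'n \<Rightarrow> complex) \<Rightarrow> bool" where
  "compact_CZ_kernel \<delta> C\<^sub>K L S D K \<longleftrightarrow>
     aux_functions L S D \<and> 0 < C\<^sub>K \<and>
     (\<forall>t x t' x'. 2 * (infnorm (t - t') + infnorm (x - x')) < infnorm (t - x) \<longrightarrow>
        cmod (K t x - K t' x')
          \<le> C\<^sub>K * ((infnorm (t - t') + infnorm (x - x')) powr \<delta>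
                   / infnorm (t - x) powr (real CARD('n) + \<delta>))
               * L (infnorm (t - x)) * S (infnorm (t - t') + infnorm (x - x'))
               * D (1 + infnorm (t + x) / (1 + infnorm (t - x)))) \<and>
     (\<forall>t x. t \<noteq> x \<longrightarrow>
        cmod (K t x)
          \<le> C\<^sub>K * (1 / infnorm (t - x) ^ CARD('n))
               * L (infnorm (t - x)) * S (infnorm (t - x))
               * D (1 + infnorm (t + x) / (1 + infnorm (t - x))))"

definition F_K ::
    "(real \<Rightarrow> real) \<Rightarrow> (real \<Rightarrow> real) \<Rightarrow> (real \<Rightarrow> real)
     \<Rightarrow> (real^'n::{finite,linorder}) set \<Rightarrow> (real^'n::{finite,linorder}) set \<Rightarrow> (real^'n::{finite,linorder}) set \<Rightarrow> real" where
  "F_K L S D I\<^sub>1 I\<^sub>2 I\<^sub>3 = L (side I\<^sub>1) * S (side I\<^sub>2) * D (rdist I\<^sub>3 unit_cube)"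

section \<open>Operators\<close>

definition supp :: "(real^'n \<Rightarrow> complex) \<Rightarrow> (real^'n) set" where
  "supp f = closure {x. f x \<noteq> 0}"

definition Cc :: "(real^'n \<Rightarrow> complex) set" where
  "Cc = {f. continuous_on UNIV f \<and> compact (supp f)}"

definition BMc :: "(real^'n \<Rightarrow> complex) set" where
  "BMc = {f. f \<in> borel_measurable lebesgue \<and> bounded (range f) \<and> compact (supp f)}"

text \<open>The topology of \<open>Cc\<close> is the usual locally convex inductive limit of the Banach spaces of
  continuous functions supported in a fixed compact set: it is generated by the seminorms
  whose restriction to each of these spaces is continuous.\<close>

definition Cc_seminorm :: "((real^'n \<Rightarrow> complex) \<Rightarrow> real) \<Rightarrow> bool" where
  "Cc_seminorm p \<longleftrightarrow>
     (\<forall>f\<in>Cc. \<forall>c. p (\<lambda>x. c * f x) = cmod c * p f) \<and>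
     (\<forall>f\<in>Cc. \<forall>g\<in>Cc. p (\<lambda>x. f x + g x) \<le> p f + p g) \<and>
     (\<forall>A. compact A \<longrightarrow> (\<exists>M. \<forall>f\<in>Cc. supp f \<subseteq> A \<longrightarrow> p f \<le> M * (SUP x. cmod (f x))))"

definition Cc_topology :: "(real^'n \<Rightarrow> complex) topology" where
  "Cc_topology = topology_generated_by
     {{g \<in> Cc. p (\<lambda>x. g x - f x) < r} | f p r. f \<in> Cc \<and> Cc_seminorm p \<and> 0 < r}"

definition Cc_dual :: "((real^'n \<Rightarrow> complex) \<Rightarrow> complex) set" where
  "Cc_dual = {\<Lambda> \<in> extensional Cc.
     (\<forall>f\<in>Cc. \<forall>g\<in>Cc. \<Lambda> (\<lambda>x. f x + g x) = \<Lambda> f + \<Lambda> g) \<and>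
     (\<forall>f\<in>Cc. \<forall>c. \<Lambda> (\<lambda>x. c * f x) = c * \<Lambda> f) \<and>
     continuous_map Cc_topology euclidean \<Lambda>}"

text \<open>The weak-* topology. As \<open>Cc\<close> is barrelled, a linear map from \<open>Cc\<close> to its dual is continuous
  for this topology iff it is continuous for the strong one.\<close>

definition Cc_dual_topology :: "((real^'n \<Rightarrow> complex) \<Rightarrow> complex) topology" where
  "Cc_dual_topology = subtopology (product_topology (\<lambda>_. euclidean) Cc) Cc_dual"

text \<open>An operator \<open>T\<close> is given by its pairing: \<open>T f g\<close> stands for \<open>\<langle>T(f), g\<rangle>\<close>. The pairing is
  bilinear on bounded measurable functions with compact support, and on \<open>Cc\<close> it comes from a
  continuous map to the dual.\<close>

definition operator_pairing ::
    "((real^'n \<Rightarrow> complex) \<Rightarrow> (real^'n \<Rightarrow> complex) \<Rightarrow> complex) \<Rightarrow> bool" where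
  "operator_pairing T \<longleftrightarrow>
     (\<forall>f\<in>BMc. \<forall>g\<in>BMc. \<forall>h\<in>BMc.
        T (\<lambda>x. f x + g x) h = T f h + T g h \<and>
        T h (\<lambda>x. f x + g x) = T h f + T h g) \<and>
     (\<forall>f\<in>BMc. \<forall>g\<in>BMc. \<forall>c.
        T (\<lambda>x. c * f x) g = c * T f g \<and> T f (\<lambda>x. c * g x) = c * T f g) \<and>
     continuous_map Cc_topology Cc_dual_topology (\<lambda>f. restrict (T f) Cc)"

definition associated ::
    "((real^'n \<Rightarrow> complex) \<Rightarrow> (real^'n \<Rightarrow> complex) \<Rightarrow> complex)
     \<Rightarrow> (real^'n \<Rightarrow> real^'n \<Rightarrow> complex) \<Rightarrow> bool" where
  "associated T K \<longleftrightarrow> (\<forall>f\<in>BMc. \<forall>g\<in>BMc. supp f \<inter> supp g = {} \<longrightarrow>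
     T f g = (LINT x|lebesgue. LINT t|lebesgue. f t * g x * K x t))"

section \<open>Bump functions and weak compactness\<close>

definition bump :: "nat \<Rightarrow> real \<Rightarrow> (real^'n) set \<Rightarrow> (real^'n \<Rightarrow> complex) \<Rightarrow> bool" where
  "bump N C I \<phi> \<longleftrightarrow>
     \<phi> \<in> borel_measurable lebesgue \<and> bounded (range \<phi>) \<and>
     (\<forall>x. cmod (\<phi> x) \<le> C * vol I powr (-1/2) / (1 + infnorm (x - center I) / side I) ^ N)"

text \<open>The implicit constant \<open>C\<^sub>W\<close> of the condition is an explicit argument.\<close>

definition weak_compactness ::
    "nat \<Rightarrow> real \<Rightarrow> ((real^'n \<Rightarrow> complex) \<Rightarrow> (real^'n \<Rightarrow> complex) \<Rightarrow> complex)
     \<Rightarrow> ((real^'n) set \<Rightarrow> real) \<Rightarrow> bool" where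
  "weak_compactness N C\<^sub>W T F\<^sub>W \<longleftrightarrow>
     F\<^sub>W ` {I. cube I} \<subseteq> {0..} \<and> bounded (F\<^sub>W ` {I. cube I}) \<and>
     (F\<^sub>W \<longlongrightarrow> 0) (inf (filtercomap side at_top) (principal {I. cube I})) \<and>
     (F\<^sub>W \<longlongrightarrow> 0) (inf (filtercomap side (at_right 0)) (principal {I. cube I})) \<and>
     (F\<^sub>W \<longlongrightarrow> 0) (inf (filtercomap (\<lambda>I. infnorm (center I)) at_top) (principal {I. cube I})) \<and>
     0 < C\<^sub>W \<and>
     (\<forall>I C \<phi> \<eta>. cube I \<and> 0 < C \<and> bump N C I \<phi> \<and> bump N C I \<eta> \<and>
        compact (supp \<phi>) \<and> compact (supp \<eta>) \<longrightarrow> cmod (T \<phi> \<eta>) \<le> C\<^sub>W * C\<^sup>2 * F\<^sub>W I)"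

end

theory Submission
  imports Defs
begin

text \<open>Only the size estimate of the kernel is needed. If \<open>rdist I J > 3\<close>, all \<open>t \<in> I\<close> and \<open>x \<in> J\<close>
  have distance comparable to the side of \<open>\<langle>I,J\<rangle>\<close>, and the kernel is bounded by a constant on
  \<open>I \<times> J\<close>. Otherwise let \<open>P\<close> be the smaller cube and \<open>R\<close> the larger one. The part of the bump
  on \<open>R\<close> that lives on \<open>3P\<close> is \<open>ec(I,J)\<^sup>1\<^sup>/\<^sup>2\<close> times a bump adapted to \<open>P\<close>, so weak compactness
  applies. On the rest, the kernel is of size \<open>\<bar>t - c(P)\<bar>\<^sup>-\<^sup>n\<close> between the scales \<open>\<ell>(P)\<close> and
  \<open>3\<ell>(R)\<close>; each of the dyadic shells in between contributes a constant, and their number gives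
  the logarithm.\<close>

section \<open>Geometry of cubes\<close>

text \<open>A positive edge length makes the box nonempty, so its interval bounds are its corners
  and the definite description in \<open>side\<close> denotes the common edge length.\<close>

lemma cube_witness:
  fixes I :: "(real^'n) set"
  assumes "cube I"
  obtains a where "0 < side I" "I = cbox a (a + (\<chi> i. side I))"
    "center I = a + (\<chi> i. side I / 2)"
    "\<forall>x. x \<in> I \<longleftrightarrow> (\<forall>i. a $ i \<le> x $ i \<and> x $ i \<le> a $ i + side I)"
proof -
  obtain a b l where l: "0 < l" and b: "\<forall>i. b $ i - a $ i = l" and I: "I = cbox a b"
    using assms by (auto simp: cube_def)
  have le: "\<forall>i\<in>Basis. a \<bullet> i \<le> b \<bullet> i"
  proof
    fix i :: "real^'n" assume "i \<in> Basis"
    then obtain j where "i = axis j 1" by (auto simp: Basis_vec_def)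
    then show "a \<bullet> i \<le> b \<bullet> i" using l b[rule_format, of j] by (simp add: inner_axis)
  qed
  have bounds: "interval_lowerbound I = a" "interval_upperbound I = b"
    using le by (simp_all add: I)
  have s: "side I = l"
    unfolding side_def bounds using b by (intro the_equality) auto
  have beq: "b = a + (\<chi> i. l)" using b by (simp add: vec_eq_iff algebra_simps)
  have "center I = a + (\<chi> i. l / 2)"
    unfolding center_def bounds by (simp add: beq vec_eq_iff midpoint_def field_simps)
  moreover have "x \<in> I \<longleftrightarrow> (\<forall>i. a $ i \<le> x $ i \<and> x $ i \<le> a $ i + l)" for x
    by (auto simp: I beq mem_box_cart)
  ultimately show thesis using that[of a] l I s beq by simp
qed

lemma side_pos: "cube I \<Longrightarrow> 0 < side I"
  by (metis cube_witness)

lemma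
  fixes a :: "real^'n"
  assumes "0 < l"
  shows cube_cbox: "cube (cbox a (a + (\<chi> i. l)))"
    and side_cbox: "side (cbox a (a + (\<chi> i. l))) = l"
    and center_cbox: "center (cbox a (a + (\<chi> i. l))) = a + (\<chi> i. l / 2)"
proof -
  let ?I = "cbox a (a + (\<chi> i. l))"
  show c: "cube ?I" unfolding cube_def
    by (rule exI[of _ a], rule exI[of _ "a + (\<chi> i. l)"]) (use assms in auto)
  have ne: "?I \<noteq> {}" using assms by (simp add: interval_ne_empty_cart)
  obtain a' where s: "0 < side ?I" and eq: "?I = cbox a' (a' + (\<chi> i. side ?I))"
    and ce: "center ?I = a' + (\<chi> i. side ?I / 2)"
    by (rule cube_witness[OF c])
  \<comment> \<open>Nonempty boxes determine their corners.\<close>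
  have *: "a = a' \<and> a + (\<chi> i. l) = a' + (\<chi> i. side ?I)"
    using eq ne eq_cbox by metis
  then show sl: "side ?I = l" by (auto simp: vec_eq_iff)
  show "center ?I = a + (\<chi> i. l / 2)" using ce * sl by simp
qed

lemma infnorm_le_cart: "(\<And>i. \<bar>x $ i\<bar> \<le> r) \<Longrightarrow> infnorm (x :: real^'n) \<le> r"
  unfolding infnorm_cart by (rule cSup_least) auto

text \<open>A cube is a closed ball of the max norm. This reduces most of the later geometry to
  triangle inequalities.\<close>

lemma mem_cube_iff:
  assumes "cube I"
  shows "x \<in> I \<longleftrightarrow> infnorm (x - center I) \<le> side I / 2"
proof -
  obtain a where s: "0 < side I" and eq: "I = cbox a (a + (\<chi> i. side I))"
    and ce: "center I = a + (\<chi> i. side I / 2)"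
    and mem: "\<forall>x. x \<in> I \<longleftrightarrow> (\<forall>i. a $ i \<le> x $ i \<and> x $ i \<le> a $ i + side I)"
    using cube_witness[OF assms] by metis
  have "x \<in> I \<longleftrightarrow> (\<forall>i. a $ i \<le> x $ i \<and> x $ i \<le> a $ i + side I)"
    using mem by blast
  also have "\<dots> \<longleftrightarrow> (\<forall>i. \<bar>(x - center I) $ i\<bar> \<le> side I / 2)"
    by (simp add: ce abs_le_iff field_simps)
      (smt (verit) field_sum_of_halves)
  also have "\<dots> \<longleftrightarrow> infnorm (x - center I) \<le> side I / 2"
    by (meson component_le_infnorm_cart infnorm_le_cart order_trans)
  finally show ?thesis .
qed

lemma center_in_cube: "cube I \<Longrightarrow> center I \<in> I"
  using side_pos[of I] by (simp add: mem_cube_iff infnorm_0)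

lemma infnorm_triangle_sub: "infnorm (x - z) \<le> infnorm (x - y) + infnorm (y - z)"
  using infnorm_triangle[of "x - y" "y - z"] by simp

lemma infnorm_diff_cube:
  assumes "cube I" "x \<in> I" "y \<in> I"
  shows "infnorm (x - y) \<le> side I"
proof -
  have "infnorm (x - center I) \<le> side I / 2" "infnorm (y - center I) \<le> side I / 2"
    using assms by (simp_all add: mem_cube_iff)
  then show ?thesis
    using infnorm_triangle_sub[of x y "center I"] infnorm_sub[of y "center I"] by simp
qed

text \<open>Opposite corners of \<open>I\<close> are at distance \<open>side I\<close>, while two
  points of \<open>J\<close> are at distance at most \<open>side J\<close>.\<close>

lemma cube_mono_side:
  assumes "cube I" "cube J" "I \<subseteq> J"
  shows "side I \<le> side J"
proof -
  obtain a where s: "0 < side I"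
    and mem: "\<forall>x. x \<in> I \<longleftrightarrow> (\<forall>i. a $ i \<le> x $ i \<and> x $ i \<le> a $ i + side I)"
    using cube_witness[OF assms(1)] by metis
  have "a \<in> I" "a + (\<chi> i. side I) \<in> I" using s by (simp_all add: mem)
  then have "a \<in> J" "a + (\<chi> i. side I) \<in> J" using assms(3) by auto
  then have "infnorm (a + (\<chi> i. side I) - a) \<le> side J"
    by (intro infnorm_diff_cube assms)
  moreover have "\<bar>(a + (\<chi> i. side I) - a) $ undefined\<bar> = side I" using s by simp
  ultimately show ?thesis
    using component_le_infnorm_cart[of "a + (\<chi> i. side I) - a" undefined] by linarith
qed

text \<open>The choice in \<open>joint_cube\<close> is meaningful only if a minimiser exists. The
  smallest box around \<open>I \<union> J\<close> has corners \<open>lo\<close> and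
  \<open>hi\<close>; its longest edge \<open>s\<close> is the least possible side, and a cube of
  side \<open>s\<close> can still slide along the shorter edges.\<close>

lemma joint_cube_in_min_cubes:
  fixes I J :: "(real^'n::{finite,linorder}) set"
  assumes "cube I" "cube J"
  shows "joint_cube I J \<in> min_cubes I J"
proof -
  obtain a where sI: "0 < side I" 
    and memI: "\<forall>x. x \<in> I \<longleftrightarrow> (\<forall>i. a $ i \<le> x $ i \<and> x $ i \<le> a $ i + side I)"
    using cube_witness[OF assms(1)] by metis
  obtain b where sJ: "0 < side J" 
    and memJ: "\<forall>x. x \<in> J \<longleftrightarrow> (\<forall>i. b $ i \<le> x $ i \<and> x $ i \<le> b $ i + side J)"
    using cube_witness[OF assms(2)] by metis
  define lo where "lo i = min (a $ i) (b $ i)" for i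
  define hi where "hi i = max (a $ i + side I) (b $ i + side J)" for i
  define s where "s = Max (range (\<lambda>i. hi i - lo i))"
  have hs: "hi i - lo i \<le> s" for i
    unfolding s_def by (rule Max_ge) auto
  have "lo i < hi i" for i using sI by (auto simp: lo_def hi_def)
  then have s: "0 < s" using hs by (meson diff_gt_0_iff_gt less_le_trans)
  have mem: "a \<in> I" "a + (\<chi> i. side I) \<in> I" "b \<in> J" "b + (\<chi> i. side J) \<in> J"
    using sI sJ by (simp_all add: memI memJ)
  have bounds: "c $ i \<le> lo i \<and> hi i \<le> c $ i + l"
    if "I \<union> J \<subseteq> cbox c (c + (\<chi> i. l))" for c l i
  proof -
    have "a \<in> cbox c (c + (\<chi> i. l))" "a + (\<chi> i. side I) \<in> cbox c (c + (\<chi> i. l))"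
      "b \<in> cbox c (c + (\<chi> i. l))" "b + (\<chi> i. side J) \<in> cbox c (c + (\<chi> i. l))"
      using mem that by blast+
    then show ?thesis by (auto simp: mem_box_cart lo_def hi_def)
  qed
  \<comment> \<open>With its upper corner at \<open>hi\<close> the cube is pushed down as far as
    possible in every coordinate, in particular in the first.\<close>
  define q where "q = (\<chi> i. hi i - s)"
  define Q where "Q = cbox q (q + (\<chi> i. s))"
  have Q: "cube Q" "side Q = s" "center Q = q + (\<chi> i. s / 2)"
    using s by (simp_all add: Q_def cube_cbox side_cbox center_cbox)
  have sub: "I \<union> J \<subseteq> Q"
  proof
    fix x assume "x \<in> I \<union> J"
    then have "lo i \<le> x $ i \<and> x $ i \<le> hi i" for i
      by (auto simp: memI memJ lo_def hi_def intro: min.coboundedI1 min.coboundedI2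
        max.coboundedI1 max.coboundedI2)
    then have "hi i - s \<le> x $ i \<and> x $ i \<le> hi i" for i
      using hs[of i] by (smt (verit))
    then show "x \<in> Q" by (simp add: Q_def q_def mem_box_cart)
  qed
  have least: "s \<le> side Q'" if Q': "cube Q'" "I \<union> J \<subseteq> Q'" for Q'
  proof -
    obtain c where c: "Q' = cbox c (c + (\<chi> i. side Q'))" by (rule cube_witness[OF Q'(1)])
    have "hi i - lo i \<le> side Q'" for i using bounds[of c "side Q'" i] Q'(2) c by simp
    then show ?thesis unfolding s_def by (intro Max.boundedI) auto
  qed
  have "Q \<in> min_cubes I J" using Q sub least by (simp add: min_cubes_def)
  moreover have "center Q $ Min UNIV \<le> center Q' $ Min UNIV" if "Q' \<in> min_cubes I J" for Q'
  proof -
    have Q': "cube Q'" "I \<union> J \<subseteq> Q'" "side Q' = s"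
      using that least Q sub by (auto simp: min_cubes_def intro!: antisym)
    obtain c where c: "Q' = cbox c (c + (\<chi> i. side Q'))" "center Q' = c + (\<chi> i. side Q' / 2)"
      by (rule cube_witness[OF Q'(1)])
    \<comment> \<open>A competitor of side \<open>s\<close> has to reach \<open>hi\<close> too, so
      its lower corner is not below \<open>hi - s\<close>.\<close>
    have "hi (Min UNIV) \<le> c $ Min UNIV + s" using bounds[of c s "Min UNIV"] Q'(2,3) c(1) by simp
    then show ?thesis by (simp add: c(2) Q(3) Q'(3) q_def)
  qed
  ultimately have "\<exists>Q. Q \<in> min_cubes I J \<and>
      (\<forall>Q'\<in>min_cubes I J. center Q $ Min UNIV \<le> center Q' $ Min UNIV)" by blast
  from someI_ex[OF this] show ?thesis by (simp add: joint_cube_def)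
qed

lemma
  assumes "cube I" "cube J"
  shows cube_joint_cube: "cube (joint_cube I J)"
    and joint_cube_upper1: "I \<subseteq> joint_cube I J"
    and joint_cube_upper2: "J \<subseteq> joint_cube I J"
    and joint_cube_least: "cube Q \<Longrightarrow> I \<union> J \<subseteq> Q \<Longrightarrow> side (joint_cube I J) \<le> side Q"
  using joint_cube_in_min_cubes[OF assms] by (auto simp: min_cubes_def)

lemma joint_cube_commute: "joint_cube I J = joint_cube J I"
  by (simp add: joint_cube_def min_cubes_def Un_commute)

lemma rdist_commute: "rdist I J = rdist J I"
  by (simp add: rdist_def joint_cube_commute[of I J] max.commute)

lemma ec_commute: "ec I J = ec J I"
  by (simp add: ec_def max.commute min.commute)

text \<open>In each coordinate the two cubes project to intervals of length \<open>side I\<close>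
  and \<open>side J\<close> whose points \<open>x $ i\<close> and \<open>y $ i\<close> differ by at
  most \<open>infnorm (x - y)\<close>. Hence a cube of the stated side, placed at the coordinatewise
  minimum of the lower corners, covers both.\<close>

lemma side_joint_cube_le:
  assumes I: "cube I" and J: "cube J" and x: "x \<in> I" and y: "y \<in> J"
  shows "side (joint_cube I J) \<le> infnorm (x - y) + side I + side J"
proof -
  obtain a where sI: "0 < side I" 
    and memI: "\<forall>x. x \<in> I \<longleftrightarrow> (\<forall>i. a $ i \<le> x $ i \<and> x $ i \<le> a $ i + side I)"
    using cube_witness[OF I] by metis
  obtain b where sJ: "0 < side J" 
    and memJ: "\<forall>x. x \<in> J \<longleftrightarrow> (\<forall>i. b $ i \<le> x $ i \<and> x $ i \<le> b $ i + side J)"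
    using cube_witness[OF J] by metis
  define l where "l = infnorm (x - y) + side I + side J"
  have l: "0 < l" using sI sJ by (simp add: l_def add_nonneg_pos infnorm_pos_le)
  define c where "c = (\<chi> i. min (a $ i) (b $ i))"
  have sub: "I \<union> J \<subseteq> cbox c (c + (\<chi> i. l))"
  proof
    fix z assume z: "z \<in> I \<union> J"
    have "min (a $ i) (b $ i) \<le> z $ i \<and> z $ i \<le> min (a $ i) (b $ i) + l" for i
    proof -
      have "a $ i \<le> x $ i \<and> x $ i \<le> a $ i + side I" using x by (simp add: memI)
      moreover have "b $ i \<le> y $ i \<and> y $ i \<le> b $ i + side J" using y by (simp add: memJ)
      moreover have "(a $ i \<le> z $ i \<and> z $ i \<le> a $ i + side I) \<or> (b $ i \<le> z $ i \<and> z $ i \<le> b $ i + side J)"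
        using z by (auto simp: memI memJ)
      moreover have "\<bar>x $ i - y $ i\<bar> \<le> infnorm (x - y)" using component_le_infnorm_cart[of "x - y" i] by simp
      ultimately show ?thesis using sI sJ unfolding l_def by linarith
    qed
    then show "z \<in> cbox c (c + (\<chi> i. l))" by (simp add: mem_box_cart c_def)
  qed
  from joint_cube_least[OF I J cube_cbox[OF l] sub] have "side (joint_cube I J) \<le> l"
    by (simp only: side_cbox[OF l])
  then show ?thesis by (simp only: l_def)
qed

section \<open>The unit cube and the argument of \<open>D\<close>\<close>

lemma
  shows cube_unit_cube: "cube (unit_cube :: (real^'n) set)"
    and side_unit_cube: "side (unit_cube :: (real^'n) set) = 1"
    and zero_in_unit_cube: "0 \<in> (unit_cube :: (real^'n) set)"
proof -
  have *: "(unit_cube :: (real^'n) set) = cbox (\<chi> i. - 1/2) ((\<chi> i. - 1/2) + (\<chi> i. 1))"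
    unfolding unit_cube_def by (rule arg_cong2[where f=cbox]) (auto simp: vec_eq_iff)
  show "cube (unit_cube :: (real^'n) set)" "side (unit_cube :: (real^'n) set) = 1"
    unfolding * by (simp_all add: cube_cbox side_cbox del: vec_lambda_beta)
  show "0 \<in> (unit_cube :: (real^'n) set)" by (simp add: unit_cube_def mem_box_cart)
qed

text \<open>Turns the argument of \<open>D\<close> in the kernel bound into the one in
  \<open>F_K\<close>. If \<open>R\<close> is far from the origin then so is \<open>t\<close>, and
  \<open>2 * infnorm t \<le> infnorm (t + x) + infnorm (t - x)\<close> then forces a large sum, as
  the difference is bounded. The loss is the factor 1/4 that becomes \<kappa>.\<close>

lemma rdist_unit_cube_le:
  assumes R: "cube R" and t: "t \<in> R" and tx: "infnorm (t - x) \<le> 3 * side R"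
  shows "1 / 4 * rdist R unit_cube \<le> 1 + infnorm (t + x) / (1 + infnorm (t - x))"
proof -
  define M where "M = max (side R) 1"
  define d where "d = infnorm (t - x)"
  define p where "p = infnorm (t + x)"
  have nn: "0 \<le> d" "0 \<le> p" by (simp_all add: d_def p_def infnorm_pos_le)
  have "2 * infnorm t = infnorm ((t + x) + (t - x))"
    using infnorm_mul[of 2 t] by (simp add: scaleR_2)
  also have "\<dots> \<le> p + d" unfolding p_def d_def by (rule infnorm_triangle)
  finally have tb: "2 * infnorm t \<le> p + d" .
  have "side (joint_cube R unit_cube) \<le> infnorm t + side R + 1"
    using side_joint_cube_le[OF R cube_unit_cube t zero_in_unit_cube] by (simp add: side_unit_cube)
  \<comment> \<open>The 7/2 collects 3/2 from \<open>d / 2\<close>, 1 from \<open>side R\<close> and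
    1 from the unit cube.\<close>
  also have "\<dots> \<le> p / 2 + 7 / 2 * M" using tb tx by (simp add: M_def d_def)
  also have "\<dots> \<le> 4 * (1 + p / (1 + d)) * M"
  proof -
    have "1 + d \<le> 4 * M" using tx by (simp add: M_def d_def)
    then have "p * (1 + d) \<le> p * (4 * M)" using nn by (intro mult_left_mono) auto
    then have "p \<le> 4 * (p / (1 + d)) * M" using nn by (simp add: pos_le_divide_eq)
    moreover have "0 \<le> M" by (simp add: M_def)
    ultimately show ?thesis using nn by (simp add: algebra_simps)
  qed
  finally have "side (joint_cube R unit_cube) \<le> 4 * (1 + p / (1 + d)) * M" .
  moreover have "0 < M" by (simp add: M_def)
  ultimately have "side (joint_cube R unit_cube) / M \<le> 4 * (1 + p / (1 + d))"
    by (simp only: pos_divide_le_eq)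
  then have "1 / 4 * (side (joint_cube R unit_cube) / M) \<le> 1 / 4 * (4 * (1 + p / (1 + d)))"
    by (rule mult_left_mono) simp
  then show ?thesis by (simp add: rdist_def side_unit_cube p_def d_def M_def)
qed

section \<open>Volumes of cubes\<close>

lemma measure_cbox_cube:
  assumes "0 \<le> l"
  shows "measure lebesgue (cbox a (a + (\<chi> i. l) :: real^'n)) = l ^ CARD('n)"
  using assms by (simp add: content_cbox_cart interval_ne_empty_cart)

lemma measure_cube: "cube I \<Longrightarrow> measure lebesgue I = vol (I :: (real^'n) set)"
  by (metis cube_witness measure_cbox_cube vol_def less_imp_le)

lemma vol_pos: "cube I \<Longrightarrow> 0 < vol I"
  by (simp add: vol_def side_pos)

lemma cube_lmeasurable: "cube I \<Longrightarrow> I \<in> lmeasurable"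
  by (metis cube_witness lmeasurable_cbox)

lemma compact_cube: "cube I \<Longrightarrow> compact I"
  by (metis cube_witness compact_cbox)

lemma infnorm_ball_cube:
  assumes "0 < r"
  shows "cube {x :: real^'n. infnorm (x - c) \<le> r}" "side {x :: real^'n. infnorm (x - c) \<le> r} = 2 * r"
proof -
  define a where "a = c - (\<chi> i. r)"
  have r2: "0 < 2 * r" using assms by simp
  have "a + (\<chi> i. 2 * r / 2) = c" by (simp add: a_def)
  then have "{x. infnorm (x - c) \<le> r} = cbox a (a + (\<chi> i. 2 * r))"
    using mem_cube_iff[OF cube_cbox[OF r2, of a]]
    unfolding side_cbox[OF r2] center_cbox[OF r2] by auto
  then show "cube {x :: real^'n. infnorm (x - c) \<le> r}" "side {x :: real^'n. infnorm (x - c) \<le> r} = 2 * r"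
    using r2 by (simp_all add: cube_cbox side_cbox)
qed

section \<open>Kernel estimates\<close>

text \<open>No measurability of \<open>f\<close> is needed, because a non-integrable function has integral \<open>0\<close>.\<close>

lemma norm_integral_le_dominated:
  fixes f :: "'a \<Rightarrow> 'b::{banach, second_countable_topology}"
  assumes "integrable M h" "\<And>x. norm (f x) \<le> h x"
  shows "norm (LINT x|M. f x) \<le> (LINT x|M. h x)"
proof (cases "integrable M f")
  case True
  have "norm (LINT x|M. f x) \<le> (LINT x|M. norm (f x))" by (rule integral_norm_bound)
  also have "\<dots> \<le> (LINT x|M. h x)" by (rule integral_mono) (use True assms in auto)
  finally show ?thesis .
next
  case False
  have "0 \<le> h x" for x using assms(2)[of x] norm_ge_zero[of "f x"] by linarith
  then show ?thesis by (simp add: not_integrable_integral_eq[OF False])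
qed

text \<open>Only majorants \<open>u s * v t\<close> of product form are considered: the condition is then symmetric
  in the two arguments of the pairing without appeal to Fubini's theorem, which would need
  \<open>K\<close> to be measurable.\<close>

definition dominated ::
    "((real^'n \<Rightarrow> complex) \<Rightarrow> (real^'n \<Rightarrow> complex) \<Rightarrow> complex)
     \<Rightarrow> (real^'n \<Rightarrow> real^'n \<Rightarrow> real) \<Rightarrow> bool" where
  "dominated B k \<longleftrightarrow> (\<forall>f\<in>BMc. \<forall>g\<in>BMc. \<forall>u v.
     supp f \<inter> supp g = {} \<and> integrable lebesgue u \<and> integrable lebesgue v \<and>
     (\<forall>s t. cmod (f s) * cmod (g t) * k s t \<le> u s * v t)
     \<longrightarrow> cmod (B f g) \<le> (LINT s|lebesgue. u s) * (LINT t|lebesgue. v t))"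

text \<open>The majorant in the size condition of \<open>compact_CZ_kernel\<close>, named so that
  its symmetry in the two points can be used.\<close>

definition CZ_size ::
    "real \<Rightarrow> (real \<Rightarrow> real) \<Rightarrow> (real \<Rightarrow> real) \<Rightarrow> (real \<Rightarrow> real) \<Rightarrow> real^'n \<Rightarrow> real^'n \<Rightarrow> real" where
  "CZ_size C L S D t x = C * (1 / infnorm (t - x) ^ CARD('n))
     * L (infnorm (t - x)) * S (infnorm (t - x)) * D (1 + infnorm (t + x) / (1 + infnorm (t - x)))"

lemma CZ_size_commute: "CZ_size C L S D t x = CZ_size C L S D x t"
  by (simp add: CZ_size_def infnorm_sub[of t x] add.commute)

lemma in_supp: "f x \<noteq> 0 \<Longrightarrow> x \<in> supp f"
  unfolding supp_def by (rule subsetD[OF closure_subset]) simp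

text \<open>The majorant \<open>u t * v x\<close> is integrated first in \<open>t\<close>, then in
  \<open>x\<close>, giving the product of the two integrals. An off-diagonal bound on
  \<open>K\<close> suffices because disjoint supports make one factor vanish on the
  diagonal.\<close>

lemma dominated_associated:
  assumes as: "associated T K" and K: "\<And>t x. t \<noteq> x \<Longrightarrow> cmod (K x t) \<le> k t x"
  shows "dominated T k"
  unfolding dominated_def
proof (intro ballI allI impI, elim conjE)
  fix f g u v
  assume f: "f \<in> BMc" and g: "g \<in> BMc" and disj: "supp f \<inter> supp g = {}"
    and u: "integrable lebesgue u" and v: "integrable lebesgue v"
    and le: "\<forall>s t. cmod (f s) * cmod (g t) * k s t \<le> u s * v t"
  have pt: "cmod (f t * g x * K x t) \<le> u t * v x" for t x
  proof -
    have "cmod (f t * g x * K x t) \<le> cmod (f t) * cmod (g x) * k t x"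
    proof (cases "t = x")
      case True
      then have "f t = 0 \<or> g x = 0" using disj in_supp by blast
      then show ?thesis by auto
    next
      case False
      then show ?thesis by (simp add: norm_mult K mult_left_mono)
    qed
    then show ?thesis using le by (meson order_trans)
  qed
  have "cmod (LINT t|lebesgue. f t * g x * K x t) \<le> (LINT t|lebesgue. u t * v x)" for x
    by (rule norm_integral_le_dominated) (use u pt in auto)
  then have inner: "cmod (LINT t|lebesgue. f t * g x * K x t) \<le> (LINT t|lebesgue. u t) * v x" for x
    by simp
  have "cmod (LINT x|lebesgue. LINT t|lebesgue. f t * g x * K x t)
      \<le> (LINT x|lebesgue. (LINT t|lebesgue. u t) * v x)"
    by (rule norm_integral_le_dominated) (use v inner in auto)
  then show "cmod (T f g) \<le> (LINT s|lebesgue. u s) * (LINT t|lebesgue. v t)"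
    using as f g disj by (simp add: associated_def)
qed

text \<open>Passing to the transpose allows the smaller cube to carry the first function in every
  case.\<close>

lemma dominated_flip:
  fixes k :: "real^'n \<Rightarrow> real^'n \<Rightarrow> real"
  assumes "dominated T k" "\<And>s t. k s t = k t s"
  shows "dominated (\<lambda>f g. T g f) k"
  unfolding dominated_def
proof (intro ballI allI impI, elim conjE)
  fix f g :: "real^'n \<Rightarrow> complex" and u v
  assume *: "f \<in> BMc" "g \<in> BMc" "supp f \<inter> supp g = {}"
    "integrable lebesgue u" "integrable lebesgue v"
    and le: "\<forall>s t. cmod (f s) * cmod (g t) * k s t \<le> u s * v t"
  have "cmod (g s) * cmod (f t) * k s t \<le> v s * u t" for s t
    using le[rule_format, of t s] assms(2)[of s t] by (simp add: mult.commute mult.left_commute)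
  then have "cmod (T g f) \<le> (LINT t|lebesgue. v t) * (LINT s|lebesgue. u s)"
    using assms(1) * unfolding dominated_def by (metis Int_commute)
  then show "cmod (T g f) \<le> (LINT s|lebesgue. u s) * (LINT t|lebesgue. v t)"
    by (simp add: mult.commute)
qed

text \<open>By monotonicity, \<open>L\<close> and \<open>D\<close> are evaluated at lower bounds of
  their arguments and \<open>S\<close> at an upper bound. The lower bounds \<open>r\<close> and
  \<open>a\<close> are separate because the power may have to keep its decay in the distance while
  \<open>L\<close> sees only the side of a cube.\<close>

lemma CZ_size_le:
  assumes aux: "aux_functions L S D" and C: "0 \<le> C"
    and r: "0 < r" "r \<le> infnorm (t - x)" "a \<le> infnorm (t - x)" "0 \<le> a" "infnorm (t - x) \<le> b"
    and d: "0 \<le> d" "d \<le> 1 + infnorm (t + x) / (1 + infnorm (t - x))"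
  shows "CZ_size C L S D t (x::real^'n) \<le> C * (1 / r ^ CARD('n)) * (L a * S b * D d)"
proof -
  let ?e = "infnorm (t - x)" and ?m = "1 + infnorm (t + x) / (1 + infnorm (t - x))"
  have nn: "0 \<le> L y" "0 \<le> S y" "0 \<le> D y" if "0 \<le> y" for y
    using aux that by (auto simp: aux_functions_def)
  have L: "L ?e \<le> L a" using aux r by (auto simp: aux_functions_def monotone_on_def)
  have S: "S ?e \<le> S b" using aux r by (auto simp: aux_functions_def monotone_on_def)
  have D: "D ?m \<le> D d" using aux d by (auto simp: aux_functions_def monotone_on_def)
  have e0: "0 \<le> ?e" "0 \<le> ?m" using infnorm_pos_le d by (auto intro: order_trans)
  have b0: "0 \<le> b" using r by linarith
  have "1 / ?e ^ CARD('n) \<le> 1 / r ^ CARD('n)"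
    using r by (intro divide_left_mono power_mono mult_pos_pos zero_less_power) auto
  then have "C * (1 / ?e ^ CARD('n)) \<le> C * (1 / r ^ CARD('n))" using C by (rule mult_left_mono)
  moreover have "L ?e * S ?e * D ?m \<le> L a * S b * D d"
    using L S D nn e0 b0 r d by (intro mult_mono) auto
  ultimately have "C * (1 / ?e ^ CARD('n)) * (L ?e * S ?e * D ?m) \<le> C * (1 / r ^ CARD('n)) * (L a * S b * D d)"
    by (rule mult_mono) (use C nn e0 r in auto)
  then show ?thesis by (simp add: CZ_size_def mult.assoc)
qed

section \<open>Dyadic shells\<close>

lemma shell_exists:
  fixes r h :: real
  assumes "h \<le> r" "r < 2 ^ m * h"
  shows "\<exists>k<m. 2 ^ k * h \<le> r \<and> r \<le> 2 ^ Suc k * h"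
  using assms
proof (induction m)
  case 0
  then show ?case by simp
next
  case (Suc m)
  show ?case
  proof (cases "r < 2 ^ m * h")
    case True
    with Suc show ?thesis using less_SucI by blast
  next
    case False
    with Suc.prems show ?thesis by (intro exI[of _ m]) auto
  qed
qed

text \<open>A majorant of \<open>1 / infnorm (t - c) ^ CARD('n)\<close> between the radii
  \<open>h\<close> and \<open>2 ^ m * h\<close>. Full cubes replace the annuli, so that the integral
  is a sum of cube volumes.\<close>

definition shell_weight :: "real \<Rightarrow> nat \<Rightarrow> real^'n \<Rightarrow> real^'n \<Rightarrow> real" where
  "shell_weight h m c t =
     (\<Sum>k<m. indicat_real {t. infnorm (t - c) \<le> 2 ^ Suc k * h} t * (1 / (2 ^ k * h) ^ CARD('n)))"

text \<open>The term of the shell containing \<open>t\<close> is already large enough, and the other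
  terms are nonnegative.\<close>

lemma shell_weight_ge:
  fixes t c :: "real^'n"
  assumes "0 < h" "h \<le> infnorm (t - c)" "infnorm (t - c) < 2 ^ m * h"
  shows "1 / infnorm (t - c) ^ CARD('n) \<le> shell_weight h m c t"
proof -
  obtain k where k: "k < m" "2 ^ k * h \<le> infnorm (t - c)" "infnorm (t - c) \<le> 2 ^ Suc k * h"
    using shell_exists[OF assms(2,3)] by blast
  have "0 < infnorm (t - c)" using assms(1,2) by linarith
  then have "1 / infnorm (t - c) ^ CARD('n) \<le> 1 / (2 ^ k * h) ^ CARD('n)"
    using assms(1) k by (intro divide_left_mono power_mono mult_pos_pos zero_less_power) auto
  also have "\<dots> = indicat_real {t. infnorm (t - c) \<le> 2 ^ Suc k * h} t * (1 / (2 ^ k * h) ^ CARD('n))"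
    using k by simp
  also have "\<dots> \<le> shell_weight h m c t"
    unfolding shell_weight_def by (rule member_le_sum) (use k assms(1) in auto)
  finally show ?thesis .
qed

lemma shell_weight_nonneg: "0 < h \<Longrightarrow> 0 \<le> shell_weight h m c t"
  unfolding shell_weight_def by (intro sum_nonneg) auto

text \<open>Every shell contributes the same amount: the cube of side \<open>4 * (2 ^ k * h)\<close>
  has a volume that cancels the weight up to \<open>4 ^ CARD('n)\<close>, whatever the
  scale.\<close>

lemma
  fixes c :: "real^'n"
  assumes h: "0 < h"
  shows integrable_shell_weight: "integrable lebesgue (shell_weight h m c)"
    and integral_shell_weight: "(LINT t|lebesgue. shell_weight h m c t) = m * 4 ^ CARD('n)"
proof -
  let ?B = "\<lambda>k. {t. infnorm (t - c) \<le> 2 ^ Suc k * h}"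
  have B: "cube (?B k)" "side (?B k) = 4 * (2 ^ k * h)" for k
    using infnorm_ball_cube[of "2 ^ Suc k * h" c] h by simp_all
  have meas: "?B k \<in> lmeasurable" "measure lebesgue (?B k) = (4 * (2 ^ k * h)) ^ CARD('n)" for k
    using cube_lmeasurable[OF B(1)] measure_cube[OF B(1)] B(2)[of k] unfolding vol_def by metis+
  have i: "integrable lebesgue (indicat_real (?B k))" for k
    using meas(1)[of k] by (intro integrable_real_indicator) (auto simp only: fmeasurable_def mem_Collect_eq)
  show "integrable lebesgue (shell_weight h m c)"
    unfolding shell_weight_def by (rule Bochner_Integration.integrable_sum) (use i in auto)
  have "(LINT t|lebesgue. shell_weight h m c t)
      = (\<Sum>k<m. (LINT t|lebesgue. indicat_real (?B k) t * (1 / (2 ^ k * h) ^ CARD('n))))"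
    unfolding shell_weight_def by (rule Bochner_Integration.integral_sum) (use i in auto)
  also have "\<dots> = (\<Sum>k<m. 4 ^ CARD('n))"
  proof (rule sum.cong)
    fix k
    have "(LINT t|lebesgue. indicat_real (?B k) t * (1 / (2 ^ k * h) ^ CARD('n)))
        = (4 * (2 ^ k * h)) ^ CARD('n) * (1 / (2 ^ k * h) ^ CARD('n))"
      using meas(2)[of k] by simp
    also have "\<dots> = 4 ^ CARD('n)" using h by (simp add: power_mult_distrib)
    finally show "(LINT t|lebesgue. indicat_real (?B k) t * (1 / (2 ^ k * h) ^ CARD('n))) = 4 ^ CARD('n)" .
  qed simp
  finally show "(LINT t|lebesgue. shell_weight h m c t) = m * 4 ^ CARD('n)" by simp
qed

lemma shell_count:
  fixes r :: real
  assumes "1 \<le> r"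
  obtains m where "3 * r < 2 ^ m" "real m \<le> 4 * (1 + ln r)"
proof
  \<comment> \<open>The two extra doublings give a factor 4, which exceeds the required 3.\<close>
  define m where "m = nat \<lceil>log 2 r\<rceil> + 2"
  have l0: "0 \<le> log 2 r" using assms by simp
  have "r \<le> 2 ^ nat \<lceil>log 2 r\<rceil>"
  proof -
    have "r = 2 powr log 2 r" using assms by simp
    also have "\<dots> \<le> 2 powr real (nat \<lceil>log 2 r\<rceil>)" by (intro powr_mono of_nat_ceiling) auto
    finally show ?thesis by (simp add: powr_realpow)
  qed
  then show "3 * r < 2 ^ m" using assms by (simp add: m_def)
  have "real m \<le> log 2 r + 3" unfolding m_def using l0 by linarith
  also have "log 2 r \<le> 2 * ln r"
  proof -
    \<comment> \<open>This crude bound replaces the binary logarithm by \<open>2 * ln r\<close>,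
      whence \<open>m\<close> is at most \<open>2 * ln r + 3\<close>.\<close>
    have "1 / 2 \<le> ln (2::real)" using ln_le_minus_one[of "1/2::real"] by (simp add: ln_div)
    then have "1 * ln r \<le> (2 * ln 2) * ln r" using assms by (intro mult_right_mono) auto
    then show ?thesis by (simp add: log_def pos_divide_le_eq algebra_simps)
  qed
  finally show "real m \<le> 4 * (1 + ln r)" using ln_ge_zero[OF assms] by (simp add: algebra_simps)
qed

section \<open>Bump functions\<close>

lemma supp_subset: "closed A \<Longrightarrow> (\<And>x. f x \<noteq> 0 \<Longrightarrow> x \<in> A) \<Longrightarrow> supp f \<subseteq> A"
  unfolding supp_def by (rule closure_minimal) auto

lemma bump_in_BMc:
  assumes "cube I" "bump N C I \<phi>" "supp \<phi> \<subseteq> I"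
  shows "\<phi> \<in> BMc"
proof -
  have "compact (I \<inter> supp \<phi>)"
    by (rule compact_Int_closed[OF compact_cube[OF assms(1)]]) (simp add: supp_def)
  then have "compact (supp \<phi>)" using assms(3) by (simp add: Int_absorb1)
  with assms(2) show ?thesis by (simp add: BMc_def bump_def)
qed

lemma bump_bound:
  assumes "cube I" "0 < C" "bump N C I \<phi>"
  shows "cmod (\<phi> x) \<le> C * vol I powr (-1/2)"
proof -
  have "cmod (\<phi> x) \<le> C * vol I powr (-1/2) / (1 + infnorm (x - center I) / side I) ^ N"
    using assms(3) by (simp add: bump_def)
  also have "\<dots> \<le> C * vol I powr (-1/2) / 1"
    using assms(2) side_pos[OF assms(1)] infnorm_pos_le[of "x - center I"]
    by (intro divide_left_mono one_le_power) (auto intro!: zero_less_power add_pos_nonneg)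
  finally show ?thesis by simp
qed

lemma bump_le:
  assumes "cube I" "0 < C" "bump N C I \<phi>" "supp \<phi> \<subseteq> I"
  shows "cmod (\<phi> x) \<le> C * vol I powr (-1/2) * indicat_real I x"
proof (cases "x \<in> I")
  case True
  then show ?thesis using bump_bound[OF assms(1-3)] by simp
next
  case False
  then have "\<phi> x = 0" using assms(4) in_supp by blast
  then show ?thesis using assms(2) by simp
qed

lemma vol_powr_mult: "cube I \<Longrightarrow> vol I powr (-1/2) * vol I = vol I powr (1/2)"
  using powr_add[of "vol I" "-1/2" 1] vol_pos[of I] by simp

text \<open>Domination with \<open>u\<close> a multiple of the indicator of \<open>I\<close>. The
  kernel is to be estimated only where \<open>f\<close> and \<open>g\<close> live; elsewhere the
  left side is 0 and the majorant is nonnegative.\<close>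

lemma dominated_indicator:
  assumes dom: "dominated B k" and f: "f \<in> BMc" and g: "g \<in> BMc" and disj: "supp f \<inter> supp g = {}"
    and I: "cube I" and a: "0 \<le> a" "\<And>s. cmod (f s) \<le> a * indicat_real I s"
    and v: "integrable lebesgue v" "\<And>t. 0 \<le> v t"
    and le: "\<And>s t. s \<in> I \<Longrightarrow> g t \<noteq> 0 \<Longrightarrow> cmod (g t) * k s t \<le> v t"
  shows "cmod (B f g) \<le> a * vol I * (LINT t|lebesgue. v t)"
proof -
  have pt: "cmod (f s) * cmod (g t) * k s t \<le> (a * indicat_real I s) * v t" for s t
  proof (cases "s \<in> I \<and> g t \<noteq> 0")
    case True
    have "cmod (f s) * (cmod (g t) * k s t) \<le> cmod (f s) * v t"
      using True le by (intro mult_left_mono) auto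
    also have "\<dots> \<le> (a * indicat_real I s) * v t"
      using a v by (intro mult_right_mono) auto
    finally show ?thesis by (simp add: mult.assoc)
  next
    case False
    then have "f s = 0 \<or> g t = 0" using a(2)[of s] by auto
    then show ?thesis using a(1) v(2)[of t] by auto
  qed
  have i: "integrable lebesgue (indicat_real I)"
    using cube_lmeasurable[OF I] by (intro integrable_real_indicator) (auto simp only: fmeasurable_def mem_Collect_eq)
  then have u: "integrable lebesgue (\<lambda>s. a * indicat_real I s)" by simp
  have "cmod (B f g) \<le> (LINT s|lebesgue. a * indicat_real I s) * (LINT t|lebesgue. v t)"
    using dom f g disj u v(1) pt unfolding dominated_def by blast
  also have "(LINT s|lebesgue. a * indicat_real I s) = a * vol I"
    using measure_cube[OF I] by simp
  finally show ?thesis .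
qed

section \<open>Eccentricity and relative distance\<close>

lemma vol_mono_side: "cube I \<Longrightarrow> side I \<le> side J \<Longrightarrow> vol I \<le> vol (J :: (real^'n) set)"
  for I :: "(real^'n) set"
  unfolding vol_def by (intro power_mono) (auto dest: side_pos)

lemma ec_smaller:
  assumes "cube I" "side I \<le> side J"
  shows "ec I J = vol I / vol J"
  using vol_mono_side[OF assms] by (simp add: ec_def)

text \<open>Multiplying numerator and denominator by the larger volume gives the right side. It is
  what remains when two normalized bumps are integrated against a kernel of size
  \<open>1 / side (joint_cube I J) ^ CARD('n)\<close>.\<close>

lemma ec_rdist:
  fixes I J :: "(real^'n::{finite,linorder}) set"
  assumes "cube I" "cube J"
  shows "ec I J powr (1/2) / rdist I J ^ CARD('n)
    = vol I powr (1/2) * vol J powr (1/2) / side (joint_cube I J) ^ CARD('n)"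
proof -
  have *: "ec I J powr (1/2) / rdist I J ^ CARD('n)
      = vol I powr (1/2) * vol J powr (1/2) / side (joint_cube I J) ^ CARD('n)"
    if "cube I" "cube J" "side I \<le> side J" for I J :: "(real^'n::{finite,linorder}) set"
  proof -
    have "vol J = vol J powr (1/2) * vol J powr (1/2)"
      using vol_pos[OF that(2)] by (simp flip: powr_add)
    then have "ec I J powr (1/2) * vol J = vol I powr (1/2) * vol J powr (1/2)"
      using vol_pos[OF that(1)] vol_pos[OF that(2)]
      by (simp add: ec_smaller[OF that(1,3)] powr_divide) (simp add: field_simps)
    moreover have "rdist I J ^ CARD('n) = side (joint_cube I J) ^ CARD('n) / vol J"
      using that(3) by (simp add: rdist_def vol_def power_divide)
    ultimately show ?thesis by simp
  qed
  show ?thesis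
  proof (cases "side I \<le> side J")
    case True
    with * assms show ?thesis by blast
  next
    case False
    with *[of J I] assms show ?thesis
      by (simp add: ec_commute[of I J] rdist_commute[of I J] joint_cube_commute[of I J] mult.commute)
  qed
qed

lemma rdist_ge_1:
  assumes "cube I" "cube J"
  shows "1 \<le> rdist I J"
proof -
  have "max (side I) (side J) \<le> side (joint_cube I J)"
    by (intro max.boundedI cube_mono_side cube_joint_cube joint_cube_upper1 joint_cube_upper2 assms)
  then show ?thesis using side_pos[OF assms(1)] by (simp add: rdist_def pos_le_divide_eq)
qed

text \<open>\<open>F_K\<close> rescaled with \<kappa> = 1/4, the loss in
  \<open>rdist_unit_cube_le\<close>. The factor 4 in \<open>S\<close> also covers distances up to
  three times the side of the larger cube.\<close>

abbreviation F_K4 where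
  "F_K4 L S D \<equiv> F_K (\<lambda>y. L (1/4 * y)) (\<lambda>y. S (y / (1/4))) (\<lambda>y. D (1/4 * y))"

lemma F_K4_nonneg:
  assumes "aux_functions L S D" "cube I" "cube J" "cube Q"
  shows "0 \<le> F_K4 L S D I J Q"
proof -
  have "0 \<le> L y \<and> 0 \<le> S y \<and> 0 \<le> D y" if "0 \<le> y" for y
    using assms(1) that by (auto simp: aux_functions_def)
  moreover have "0 \<le> rdist Q unit_cube"
    using rdist_ge_1[OF assms(4) cube_unit_cube] by linarith
  ultimately show ?thesis
    using side_pos[OF assms(2)] side_pos[OF assms(3)] by (auto simp: F_K_def intro!: mult_nonneg_nonneg)
qed

section \<open>Distant cubes\<close>

text \<open>Both sides are below a third of \<open>side Q\<close>, so
  \<open>side_joint_cube_le\<close> leaves a distance of at least \<open>side Q / 3\<close> between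
  points of the two cubes. This third is the source of \<open>3 ^ CARD('n)\<close>.\<close>

lemma distant_estimate:
  fixes I J :: "(real^'n::{finite,linorder}) set"
  assumes dom: "dominated B (CZ_size C\<^sub>K L S D)" and aux: "aux_functions L S D" and CK: "0 \<le> C\<^sub>K"
    and I: "cube I" and J: "cube J" and C: "0 < C"
    and \<phi>: "bump N C I \<phi>" "supp \<phi> \<subseteq> I" and \<eta>: "bump N C J \<eta>" "supp \<eta> \<subseteq> J"
    and far: "rdist I J > 3"
  defines "Q \<equiv> joint_cube I J"
  shows "cmod (B \<phi> \<eta>) \<le> 3 ^ CARD('n) * C\<^sub>K * C\<^sup>2 * (ec I J powr (1/2) / rdist I J ^ CARD('n))
    * F_K4 L S D Q Q Q"
proof -
  define s where "s = side Q"
  define k where "k = C\<^sub>K * (1 / (s / 3) ^ CARD('n)) * F_K4 L S D Q Q Q"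
  have Q: "cube Q" "I \<subseteq> Q" "J \<subseteq> Q"
    using I J by (simp_all add: Q_def cube_joint_cube joint_cube_upper1 joint_cube_upper2)
  have s: "0 < s" using side_pos[OF Q(1)] by (simp add: s_def)
  have small: "side I < s / 3" "side J < s / 3"
    using far side_pos[OF I] by (auto simp: rdist_def s_def Q_def pos_less_divide_eq)
  have dist: "s / 3 \<le> infnorm (t - x)" "infnorm (t - x) \<le> s" if "t \<in> I" "x \<in> J" for t x
    using side_joint_cube_le[OF I J that] small infnorm_diff_cube[OF Q(1), of t x] that Q
    by (auto simp: s_def Q_def)
  have "x \<notin> J" if "x \<in> I" for x using dist(1)[OF that, of x] s by (auto simp: infnorm_0)
  then have disj: "supp \<phi> \<inter> supp \<eta> = {}" using \<phi>(2) \<eta>(2) by blast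
  have k0: "0 \<le> k" unfolding k_def using CK s F_K4_nonneg[OF aux Q(1) Q(1) Q(1)] by simp
  have size: "CZ_size C\<^sub>K L S D t x \<le> k" if "t \<in> I" "x \<in> J" for t x
    unfolding k_def F_K_def
  proof (rule CZ_size_le[OF aux CK])
    show "1 / 4 * rdist Q unit_cube \<le> 1 + infnorm (t + x) / (1 + infnorm (t - x))"
      using Q that dist(2)[OF that] s by (intro rdist_unit_cube_le) (auto simp: s_def)
    show "0 \<le> 1 / 4 * rdist Q unit_cube" using rdist_ge_1[OF Q(1) cube_unit_cube] by simp
  qed (use dist[OF that] s in \<open>auto simp: s_def\<close>)
  have i: "integrable lebesgue (indicat_real J)"
    using cube_lmeasurable[OF J] by (intro integrable_real_indicator) (auto simp only: fmeasurable_def mem_Collect_eq)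
  have "cmod (B \<phi> \<eta>) \<le> C * vol I powr (-1/2) * vol I
      * (LINT t|lebesgue. C * vol J powr (-1/2) * k * indicat_real J t)"
  proof (rule dominated_indicator[OF dom _ _ disj I _ bump_le[OF I C \<phi>]])
    fix t x assume t: "t \<in> I" and x: "\<eta> x \<noteq> 0"
    then have xJ: "x \<in> J" using \<eta>(2) in_supp by blast
    have "cmod (\<eta> x) * CZ_size C\<^sub>K L S D t x \<le> cmod (\<eta> x) * k"
      by (intro mult_left_mono size t xJ) simp
    also have "\<dots> \<le> (C * vol J powr (-1/2) * indicat_real J x) * k"
      by (intro mult_right_mono bump_le[OF J C \<eta>] k0)
    finally show "cmod (\<eta> x) * CZ_size C\<^sub>K L S D t x \<le> C * vol J powr (-1/2) * k * indicat_real J x"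
      by (simp add: mult_ac)
  qed (use C k0 i I J \<phi> \<eta> in \<open>auto intro: bump_in_BMc simp: less_imp_le\<close>)
  \<comment> \<open>Up to the factor \<open>C\<close>, each bracket bounds the L1 norm of one
    bump.\<close>
  also have "\<dots> = C\<^sup>2 * k * (vol I powr (-1/2) * vol I) * (vol J powr (-1/2) * vol J)"
    using measure_cube[OF J] by (simp add: power2_eq_square)
  also have "\<dots> = 3 ^ CARD('n) * C\<^sub>K * C\<^sup>2 * (vol I powr (1/2) * vol J powr (1/2) / s ^ CARD('n))
      * F_K4 L S D Q Q Q"
    unfolding vol_powr_mult[OF I] vol_powr_mult[OF J] k_def by (simp add: power_divide)
  also have "vol I powr (1/2) * vol J powr (1/2) / s ^ CARD('n) = ec I J powr (1/2) / rdist I J ^ CARD('n)"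
    unfolding s_def Q_def by (rule ec_rdist[OF I J, symmetric])
  finally show ?thesis .
qed

section \<open>Close cubes\<close>

text \<open>The bump on \<open>R\<close> is cut at the triple of \<open>P\<close>: weak compactness
  bounds the inner part and the shells bound the outer one. \<open>B\<close> is a variable so that
  it can stand for the operator and for its transpose.\<close>

lemma close_estimate:
  fixes P R :: "(real^'n::{finite,linorder}) set"
  assumes dom: "dominated B (CZ_size C\<^sub>K L S D)" and aux: "aux_functions L S D" and CK: "0 \<le> C\<^sub>K"
    and wc: "weak_compactness N C\<^sub>W B F\<^sub>W"
    and add: "\<And>f g h. f \<in> BMc \<Longrightarrow> g \<in> BMc \<Longrightarrow> h \<in> BMc \<Longrightarrow> B h (\<lambda>x. f x + g x) = B h f + B h g"
    and scale: "\<And>f h c. f \<in> BMc \<Longrightarrow> h \<in> BMc \<Longrightarrow> B h (\<lambda>x. c * f x) = c * B h f"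
    and P: "cube P" and R: "cube R" and PR: "side P \<le> side R" and C: "0 < C"
    and \<phi>: "bump N C P \<phi>" "supp \<phi> \<subseteq> P" and \<eta>: "bump N C R \<eta>" "supp \<eta> \<subseteq> R"
    and near: "rdist P R \<le> 3"
  shows "cmod (B \<phi> \<eta>) \<le> C\<^sup>2 * ec P R powr (1/2)
    * (9 ^ N * C\<^sub>W * F\<^sub>W P + 4 * 6 ^ CARD('n) * C\<^sub>K * (1 + \<bar>ln (ec P R)\<bar>) * F_K4 L S D P R R)"
proof -
  define c where "c = center P"
  define h where "h = side P"
  define F where "F = F_K4 L S D P R R"
  define e where "e = ec P R powr (1/2)"
  have h: "0 < h" using side_pos[OF P] by (simp add: h_def)
  have R0: "0 < side R" by (rule side_pos[OF R])
  have F0: "0 \<le> F" unfolding F_def by (rule F_K4_nonneg[OF aux P R R])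
  have ec: "ec P R = vol P / vol R" by (rule ec_smaller[OF P PR])
  have vP: "0 < vol P" and vR: "0 < vol R" using vol_pos P R by auto
  have e0: "0 < e" using vP vR by (simp add: e_def ec)
  \<comment> \<open>Comparing the normalizations of the two cubes produces \<open>e\<close>, the
    square root of the eccentricity, in the inner part; \<open>eR\<close> does the same for the
    outer part.\<close>
  have eP: "vol R powr (-1/2) = e * vol P powr (-1/2)"
    using vP vR by (simp add: e_def ec powr_divide powr_minus field_simps)
  have eR: "vol R powr (-1/2) * vol P powr (1/2) = e"
    using vP vR by (simp add: e_def ec powr_divide powr_minus field_simps)
  \<comment> \<open>The triple of \<open>P\<close>: points outside it are at distance more than
    \<open>h\<close> from \<open>P\<close>.\<close>
  define A where "A = {t. infnorm (t - c) \<le> 3 / 2 * h}"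
  have A: "cube A" using infnorm_ball_cube(1)[of "3/2 * h" c] h by (simp add: A_def)
  have Ameas: "A \<in> sets lebesgue" using cube_lmeasurable[OF A] by (rule fmeasurableD)
  define \<eta>1 where "\<eta>1 = (\<lambda>t. if t \<in> A then \<eta> t else 0)"
  define \<eta>2 where "\<eta>2 = (\<lambda>t. if t \<in> A then 0 else \<eta> t)"
  have \<phi>B: "\<phi> \<in> BMc" and \<eta>B: "\<eta> \<in> BMc" using bump_in_BMc P R \<phi> \<eta> by blast+
  \<comment> \<open>A sharp cut-off destroys continuity but stays in \<open>BMc\<close>, on which
    the pairing is bilinear.\<close>
  have BMc_if: "f \<in> BMc" if "f \<in> borel_measurable lebesgue" "\<And>t. f t = 0 \<or> f t = \<eta> t" for f
  proof -
    have "supp f \<subseteq> supp \<eta>" unfolding supp_def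
      by (rule closure_mono) (use that(2) in force)
    then have "compact (supp \<eta> \<inter> supp f)" "supp \<eta> \<inter> supp f = supp f"
      using \<eta>B by (auto simp: BMc_def supp_def intro!: compact_Int_closed)
    moreover have "bounded (range f)"
    proof (rule bounded_subset)
      show "bounded (insert 0 (range \<eta>))" using \<eta>B by (simp add: BMc_def)
      show "range f \<subseteq> insert 0 (range \<eta>)" using that(2) by (metis image_subset_iff insertCI rangeI)
    qed
    ultimately show ?thesis using that(1) by (simp add: BMc_def)
  qed
  have \<eta>m: "\<eta> \<in> borel_measurable lebesgue" using \<eta>B by (simp add: BMc_def)
  have \<eta>1B: "\<eta>1 \<in> BMc" and \<eta>2B: "\<eta>2 \<in> BMc"
    by (rule BMc_if; use \<eta>m Ameas in \<open>auto simp: \<eta>1_def \<eta>2_def intro!: measurable_If_set\<close>)+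
  have "B \<phi> \<eta> = B \<phi> (\<lambda>x. \<eta>1 x + \<eta>2 x)"
    by (rule arg_cong[where f="B \<phi>"]) (auto simp: \<eta>1_def \<eta>2_def)
  also have "\<dots> = B \<phi> \<eta>1 + B \<phi> \<eta>2" by (rule add[OF \<eta>1B \<eta>2B \<phi>B])
  finally have split: "cmod (B \<phi> \<eta>) \<le> cmod (B \<phi> \<eta>1) + cmod (B \<phi> \<eta>2)"
    using norm_triangle_ineq by simp

  text \<open>Near \<open>P\<close>, the rescaled large bump \<open>\<eta>1 / e\<close> is itself adapted to \<open>P\<close>.\<close>

  define \<zeta> where "\<zeta> = (\<lambda>x. complex_of_real (1 / e) * \<eta>1 x)"
  have C3: "C \<le> 3 ^ N * C" using C by simp
  have \<zeta>: "bump N (3 ^ N * C) P \<zeta>"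
    unfolding bump_def
  proof (intro conjI allI)
    have [measurable]: "\<eta>1 \<in> borel_measurable lebesgue" using \<eta>1B by (simp add: BMc_def)
    show "\<zeta> \<in> borel_measurable lebesgue" unfolding \<zeta>_def by measurable
    have "bounded (range \<eta>1)" using \<eta>1B by (simp add: BMc_def)
    from bounded_linear_image[OF this bounded_linear_mult_right]
    show "bounded (range \<zeta>)" by (simp only: \<zeta>_def image_image)
    fix x
    show "cmod (\<zeta> x) \<le> 3 ^ N * C * vol P powr (-1/2) / (1 + infnorm (x - center P) / side P) ^ N"
    proof (cases "x \<in> A")
      case True
      have "cmod (\<eta> x) \<le> e * (C * vol P powr (-1/2))"
        using bump_bound[OF R C \<eta>(1), of x] unfolding eP by (simp only: mult_ac)
      then have "cmod (\<zeta> x) \<le> C * vol P powr (-1/2)"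
        using True e0 by (simp add: \<zeta>_def \<eta>1_def norm_mult norm_divide pos_divide_le_eq mult.commute)
      also have "\<dots> = 3 ^ N * C * vol P powr (-1/2) / 3 ^ N" by simp
      also have "\<dots> \<le> 3 ^ N * C * vol P powr (-1/2) / (1 + infnorm (x - center P) / side P) ^ N"
      proof (rule divide_left_mono)
        \<comment> \<open>On \<open>A\<close> the quotient is at most 3/2; rounding up to 2 bounds
          the decay weight by \<open>3 ^ N\<close>.\<close>
        have q: "0 \<le> infnorm (x - center P) / side P" "infnorm (x - center P) / side P \<le> 2"
          using True h by (auto simp: A_def c_def h_def infnorm_pos_le pos_divide_le_eq)
        then show "(1 + infnorm (x - center P) / side P) ^ N \<le> 3 ^ N" by (intro power_mono) linarith+
        show "0 < 3 ^ N * (1 + infnorm (x - center P) / side P) ^ N"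
          using q(1) by (intro mult_pos_pos zero_less_power add_pos_nonneg) auto
      qed (use C in simp)
      finally show ?thesis .
    next
      case False
      then show ?thesis using C h infnorm_pos_le[of "x - center P"]
        by (simp add: \<zeta>_def \<eta>1_def h_def)
    qed
  qed
  \<comment> \<open>Weak compactness takes one constant for both bumps, so \<open>\<phi>\<close> is
    also given the larger one. Its square yields \<open>9 ^ N\<close>.\<close>
  have \<phi>3: "bump N (3 ^ N * C) P \<phi>"
    unfolding bump_def
  proof (intro conjI allI)
    fix x
    have "cmod (\<phi> x) \<le> C * vol P powr (-1/2) / (1 + infnorm (x - center P) / side P) ^ N"
      using \<phi>(1) by (simp add: bump_def)
    also have "\<dots> \<le> 3 ^ N * C * vol P powr (-1/2) / (1 + infnorm (x - center P) / side P) ^ N"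
      using C3 h infnorm_pos_le[of "x - center P"]
      by (intro divide_right_mono mult_right_mono) (auto simp: h_def)
    finally show "cmod (\<phi> x) \<le> \<dots>" .
  qed (use \<phi>(1) in \<open>auto simp: bump_def\<close>)
  have "supp \<zeta> = supp \<eta>1" using e0 by (simp add: \<zeta>_def supp_def)
  then have "compact (supp \<zeta>)" "compact (supp \<phi>)" using \<eta>1B \<phi>B by (auto simp: BMc_def)
  then have "cmod (B \<phi> \<zeta>) \<le> C\<^sub>W * (3 ^ N * C)\<^sup>2 * F\<^sub>W P"
    using wc \<zeta> \<phi>3 P C by (simp add: weak_compactness_def)
  moreover have "B \<phi> \<zeta> = complex_of_real (1 / e) * B \<phi> \<eta>1"
    unfolding \<zeta>_def by (rule scale[OF \<eta>1B \<phi>B])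
  moreover have "((3::real) ^ N)\<^sup>2 = 9 ^ N" by (simp flip: power_mult_distrib add: power2_eq_square)
  ultimately have near_part: "cmod (B \<phi> \<eta>1) \<le> C\<^sup>2 * e * (9 ^ N * C\<^sub>W * F\<^sub>W P)"
    using e0 by (simp add: norm_mult norm_divide power_mult_distrib pos_divide_le_eq mult_ac)

  text \<open>Away from \<open>P\<close>, \<open>\<bar>s - t\<bar>\<close> is comparable to \<open>\<bar>t - c\<bar>\<close> for \<open>s \<in> P\<close>, so the kernel is
    bounded by a function of \<open>t\<close> alone.\<close>

  have r1: "1 \<le> side R / h" using PR h by (simp add: h_def)
  obtain m where m: "3 * (side R / h) < 2 ^ m" "real m \<le> 4 * (1 + ln (side R / h))"
    by (rule shell_count[OF r1])
  have sJ: "side (joint_cube P R) \<le> 3 * side R"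
    using near PR R0 by (simp add: rdist_def pos_divide_le_eq)
  have dJ: "infnorm (x - y) \<le> 3 * side R" if "x \<in> P" "y \<in> R" for x y
    using infnorm_diff_cube[OF cube_joint_cube[OF P R], of x y] that sJ
      joint_cube_upper1[OF P R] joint_cube_upper2[OF P R] by fastforce
  have cP: "c \<in> P" using center_in_cube[OF P] by (simp add: c_def)
  define b where "b = C * vol R powr (-1/2)"
  \<comment> \<open>The power of 3/2 comes from
    \<open>infnorm (s - t) \<ge> 2 / 3 * infnorm (t - c)\<close>.\<close>
  define a where "a = C\<^sub>K * (3 / 2) ^ CARD('n) * F"
  have b0: "0 \<le> b" using C by (simp add: b_def)
  have a0: "0 \<le> a" using CK F0 by (simp add: a_def)
  have size: "CZ_size C\<^sub>K L S D s t \<le> a * shell_weight h m c t"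
    if s: "s \<in> P" and t: "t \<in> R" "t \<notin> A" for s t
  proof -
    define r where "r = infnorm (t - c)"
    have r: "3 / 2 * h < r" using t by (simp add: A_def r_def)
    have sc: "infnorm (s - c) \<le> h / 2"
      using s mem_cube_iff[OF P] by (simp add: c_def h_def)
    \<comment> \<open>Outside \<open>A\<close>, the radius \<open>h / 2\<close> of \<open>P\<close>
      is less than a third of \<open>r\<close>.\<close>
    have st: "2 / 3 * r \<le> infnorm (s - t)"
      using infnorm_triangle_sub[of t c s] infnorm_sub[of t s] sc r by (simp add: r_def)
    have rh: "r < 2 ^ m * h"
    proof -
      have "r \<le> 3 * side R" using dJ[OF cP t(1)] infnorm_sub[of c t] by (simp add: r_def)
      also have "\<dots> < 2 ^ m * h" using m(1) h by (simp add: pos_divide_less_eq)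
      finally show ?thesis .
    qed
    have "CZ_size C\<^sub>K L S D s t \<le> C\<^sub>K * (1 / (2 / 3 * r) ^ CARD('n)) * F"
      unfolding F_def F_K_def
    proof (rule CZ_size_le[OF aux CK])
      \<comment> \<open>The point of \<open>R\<close> has to come first here, so sum and difference
        are swapped afterwards.\<close>
      have "1 / 4 * rdist R unit_cube \<le> 1 + infnorm (t + s) / (1 + infnorm (t - s))"
        using dJ[OF s t(1)] infnorm_sub[of t s] by (intro rdist_unit_cube_le R t) simp
      then show "1 / 4 * rdist R unit_cube \<le> 1 + infnorm (s + t) / (1 + infnorm (s - t))"
        unfolding infnorm_sub[of t s] add.commute[of t s] .
      show "0 \<le> 1 / 4 * rdist R unit_cube" using rdist_ge_1[OF R cube_unit_cube] by simp
    qed (use st r h R0 dJ[OF s t(1)] in \<open>auto simp: h_def\<close>)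
    also have "\<dots> = a * (1 / r ^ CARD('n))" by (simp add: a_def power_mult_distrib power_divide)
    also have "\<dots> \<le> a * shell_weight h m c t"
      using shell_weight_ge[of h t c m] r rh h a0 by (intro mult_left_mono) (auto simp: r_def)
    finally show ?thesis .
  qed
  \<comment> \<open>The support is a closure, so the strict inequality outside \<open>A\<close>
    weakens; the gap between the radii \<open>h / 2\<close> and \<open>3 / 2 * h\<close> still
    separates the supports.\<close>
  have "supp \<eta>2 \<subseteq> {t. 3 / 2 * h \<le> infnorm (t - c)}"
    by (rule supp_subset) (auto intro!: closed_Collect_le continuous_intros simp: \<eta>2_def A_def split: if_splits)
  moreover have "supp \<phi> \<subseteq> {t. infnorm (t - c) \<le> h / 2}"
    using \<phi>(2) mem_cube_iff[OF P] by (auto simp: c_def h_def)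
  ultimately have disj: "supp \<phi> \<inter> supp \<eta>2 = {}" using h by fastforce
  have "cmod (B \<phi> \<eta>2) \<le> C * vol P powr (-1/2) * vol P
      * (LINT t|lebesgue. b * a * shell_weight h m c t)"
  proof (rule dominated_indicator[OF dom \<phi>B \<eta>2B disj P _ bump_le[OF P C \<phi>]])
    fix s t assume s: "s \<in> P" and nz: "\<eta>2 t \<noteq> 0"
    then have t: "t \<in> R" "t \<notin> A" and eq: "\<eta>2 t = \<eta> t"
      using \<eta>(2) in_supp by (auto simp: \<eta>2_def split: if_splits)
    have "cmod (\<eta>2 t) * CZ_size C\<^sub>K L S D s t \<le> cmod (\<eta>2 t) * (a * shell_weight h m c t)"
      by (intro mult_left_mono size s t) simp
    also have "\<dots> \<le> b * (a * shell_weight h m c t)"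
      using bump_bound[OF R C \<eta>(1)] a0 shell_weight_nonneg[OF h]
      by (intro mult_right_mono mult_nonneg_nonneg) (auto simp: eq b_def)
    finally show "cmod (\<eta>2 t) * CZ_size C\<^sub>K L S D s t \<le> b * a * shell_weight h m c t"
      by (simp add: mult.assoc)
  qed (use C a0 b0 h in \<open>auto intro: integrable_shell_weight intro!: mult_nonneg_nonneg shell_weight_nonneg simp: less_imp_le\<close>)
  also have "\<dots> = C\<^sup>2 * (vol R powr (-1/2) * (vol P powr (-1/2) * vol P)) * C\<^sub>K * F
      * ((3 / 2) ^ CARD('n) * 4 ^ CARD('n)) * m"
    by (simp add: integral_shell_weight[OF h] a_def b_def power2_eq_square)
  also have "\<dots> = C\<^sup>2 * e * C\<^sub>K * F * 6 ^ CARD('n) * m"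
    unfolding vol_powr_mult[OF P] eR by (simp flip: power_mult_distrib)
  \<comment> \<open>Since \<open>\<bar>ln (ec P R)\<bar>\<close> is \<open>CARD('n)\<close> times
    the logarithm of the ratio of sides, it dominates that logarithm and hence the number of
    shells.\<close>
  also have "\<dots> \<le> C\<^sup>2 * e * C\<^sub>K * F * 6 ^ CARD('n) * (4 * (1 + \<bar>ln (ec P R)\<bar>))"
  proof (rule mult_left_mono)
    have "ec P R = inverse ((side R / h) ^ CARD('n))" by (simp add: ec vol_def h_def power_divide)
    then have "ln (ec P R) = - (CARD('n) * ln (side R / h))"
      using r1 by (simp only: ln_inverse ln_realpow zero_less_power less_le_trans[OF zero_less_one])
    then have "\<bar>ln (ec P R)\<bar> = CARD('n) * ln (side R / h)"
      using ln_ge_zero[OF r1] by (simp only: abs_minus_cancel abs_mult abs_of_nat abs_of_nonneg)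
    moreover have "1 * ln (side R / h) \<le> CARD('n) * ln (side R / h)"
      using r1 by (intro mult_right_mono ln_ge_zero) (auto simp: Suc_le_eq)
    ultimately show "real m \<le> 4 * (1 + \<bar>ln (ec P R)\<bar>)" using m(2) by simp
  qed (use C e0 CK F0 in simp)
  finally have far_part: "cmod (B \<phi> \<eta>2) \<le> C\<^sup>2 * e * (4 * 6 ^ CARD('n) * C\<^sub>K * (1 + \<bar>ln (ec P R)\<bar>) * F)"
    by (simp only: mult_ac)
  have "cmod (B \<phi> \<eta>) \<le> C\<^sup>2 * e * (9 ^ N * C\<^sub>W * F\<^sub>W P)
      + C\<^sup>2 * e * (4 * 6 ^ CARD('n) * C\<^sub>K * (1 + \<bar>ln (ec P R)\<bar>) * F)"
    using split near_part far_part by linarith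
  then show ?thesis by (simp only: distrib_left e_def F_def)
qed

text \<open>Both bumps range over the same class, so the condition is symmetric.\<close>

lemma weak_compactness_flip:
  "weak_compactness N C\<^sub>W T F\<^sub>W \<Longrightarrow> weak_compactness N C\<^sub>W (\<lambda>f g. T g f) F\<^sub>W"
  by (simp add: weak_compactness_def)

section \<open>Assembly of the two cases\<close>

theorem proposition3p3:
  fixes \<delta> :: real
  assumes "0 < \<delta>" and "\<delta> < 1"
  shows "\<exists>\<kappa>. 0 < \<kappa> \<and> \<kappa> \<le> 1 \<and>
    (\<forall>(T :: (real^'n::{finite,linorder} \<Rightarrow> complex) \<Rightarrow> (real^'n::{finite,linorder} \<Rightarrow> complex) \<Rightarrow> complex) N C\<^sub>K C\<^sub>W.
      \<exists>A>0. \<forall>K L S D F\<^sub>W.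
        operator_pairing T \<and> compact_CZ_kernel \<delta> C\<^sub>K L S D K \<and> associated T K \<and>
        weak_compactness N C\<^sub>W T F\<^sub>W \<longrightarrow>
        (\<forall>I J \<psi>\<^sub>I \<psi>\<^sub>J C.
          cube I \<and> cube J \<and> 0 < C \<and>
          bump N C I \<psi>\<^sub>I \<and> supp \<psi>\<^sub>I \<subseteq> I \<and> bump N C J \<psi>\<^sub>J \<and> supp \<psi>\<^sub>J \<subseteq> J \<longrightarrow>
          (let F\<^sub>K = F_K (\<lambda>y. L (\<kappa> * y)) (\<lambda>y. S (y / \<kappa>)) (\<lambda>y. D (\<kappa> * y));
               \<theta> = (if rdist I J > 3 then 0 else 1 :: nat);
               F = (if rdist I J > 3
                    then F\<^sub>K (joint_cube I J) (joint_cube I J) (joint_cube I J)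
                    else F\<^sub>W (smaller_cube I J)
                         + F\<^sub>K (smaller_cube I J) (larger_cube I J) (larger_cube I J))
           in cmod (T \<psi>\<^sub>I \<psi>\<^sub>J)
                \<le> A * C\<^sup>2 * (ec I J powr (1/2) / rdist I J ^ CARD('n))
                    * (1 + \<bar>ln (ec I J)\<bar> ^ \<theta>) * F)))"
proof (rule exI[of _ "1/4"], intro conjI allI)
  fix T :: "(real^'n::{finite,linorder} \<Rightarrow> complex) \<Rightarrow> (real^'n::{finite,linorder} \<Rightarrow> complex) \<Rightarrow> complex"
  fix N :: nat and C\<^sub>K C\<^sub>W :: real
  \<comment> \<open>\<open>A\<close> is fixed before any hypothesis on the constants is available;
    the absolute values and the summand 1 keep it positive. In the close case
    \<open>3 ^ CARD('n)\<close> pays for the power of \<open>rdist\<close>.\<close>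
  define A where "A = 3 ^ CARD('n) * (9 ^ N * \<bar>C\<^sub>W\<bar> + 4 * 6 ^ CARD('n) * \<bar>C\<^sub>K\<bar>) + 1"
  have A: "0 < A" unfolding A_def by (intro add_nonneg_pos mult_nonneg_nonneg add_nonneg_nonneg) auto
  show "\<exists>A>0. \<forall>K L S D F\<^sub>W.
        operator_pairing T \<and> compact_CZ_kernel \<delta> C\<^sub>K L S D K \<and> associated T K \<and>
        weak_compactness N C\<^sub>W T F\<^sub>W \<longrightarrow>
        (\<forall>I J \<psi>\<^sub>I \<psi>\<^sub>J C.
          cube I \<and> cube J \<and> 0 < C \<and>
          bump N C I \<psi>\<^sub>I \<and> supp \<psi>\<^sub>I \<subseteq> I \<and> bump N C J \<psi>\<^sub>J \<and> supp \<psi>\<^sub>J \<subseteq> J \<longrightarrow>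
          (let F\<^sub>K = F_K4 L S D;
               \<theta> = (if rdist I J > 3 then 0 else 1 :: nat);
               F = (if rdist I J > 3
                    then F\<^sub>K (joint_cube I J) (joint_cube I J) (joint_cube I J)
                    else F\<^sub>W (smaller_cube I J)
                         + F\<^sub>K (smaller_cube I J) (larger_cube I J) (larger_cube I J))
           in cmod (T \<psi>\<^sub>I \<psi>\<^sub>J)
                \<le> A * C\<^sup>2 * (ec I J powr (1/2) / rdist I J ^ CARD('n))
                    * (1 + \<bar>ln (ec I J)\<bar> ^ \<theta>) * F))"
  proof (intro exI[of _ A] conjI A allI impI, elim conjE)
    fix K L S D F\<^sub>W and I J :: "(real^'n::{finite,linorder}) set" and \<psi>\<^sub>I \<psi>\<^sub>J C
    assume T: "operator_pairing T" and K: "compact_CZ_kernel \<delta> C\<^sub>K L S D K" and TK: "associated T K"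
      and wc: "weak_compactness N C\<^sub>W T F\<^sub>W" and I: "cube I" and J: "cube J" and C: "0 < C"
      and \<psi>I: "bump N C I \<psi>\<^sub>I" "supp \<psi>\<^sub>I \<subseteq> I" and \<psi>J: "bump N C J \<psi>\<^sub>J" "supp \<psi>\<^sub>J \<subseteq> J"
    have aux: "aux_functions L S D" and CK: "0 \<le> C\<^sub>K" using K by (simp_all add: compact_CZ_kernel_def)
    have CW: "0 \<le> C\<^sub>W" using wc by (simp add: weak_compactness_def)
    have FW: "0 \<le> F\<^sub>W Q" if "cube Q" for Q using wc that by (auto simp: weak_compactness_def)
    \<comment> \<open>\<open>associated\<close> integrates \<open>K x t\<close> with
      \<open>t\<close> the variable of the first function; the symmetry of the majorant absorbs the
      swap.\<close>
    have "cmod (K x t) \<le> CZ_size C\<^sub>K L S D t x" if "t \<noteq> x" for t x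
    proof -
      have "cmod (K x t) \<le> CZ_size C\<^sub>K L S D x t"
        using K that[symmetric] unfolding compact_CZ_kernel_def CZ_size_def by blast
      then show ?thesis by (simp only: CZ_size_commute)
    qed
    then have dom: "dominated T (CZ_size C\<^sub>K L S D)" by (rule dominated_associated[OF TK])
    have dom': "dominated (\<lambda>f g. T g f) (CZ_size C\<^sub>K L S D)"
      by (rule dominated_flip[OF dom CZ_size_commute])
    let ?r = "ec I J powr (1/2) / rdist I J ^ CARD('n)"
    have r1: "1 \<le> rdist I J" by (rule rdist_ge_1[OF I J])
    have r0: "0 \<le> ?r" using r1 by simp
    \<comment> \<open>The factor 2 is the value of the logarithmic factor at \<theta> = 0.\<close>
    have "cmod (T \<psi>\<^sub>I \<psi>\<^sub>J) \<le> A * C\<^sup>2 * ?r * 2 * F_K4 L S D (joint_cube I J) (joint_cube I J) (joint_cube I J)"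
      if "rdist I J > 3"
    proof -
      let ?Q = "joint_cube I J"
      have Q: "cube ?Q" by (rule cube_joint_cube[OF I J])
      have "1 \<le> (4 * 6 ^ CARD('n) :: real)" using one_le_power[of "6::real" "CARD('n)"] by linarith
      then have "1 * C\<^sub>K \<le> 4 * 6 ^ CARD('n) * C\<^sub>K" using CK by (rule mult_right_mono)
      moreover have "0 \<le> 9 ^ N * C\<^sub>W" using CW by simp
      ultimately have "C\<^sub>K \<le> 9 ^ N * \<bar>C\<^sub>W\<bar> + 4 * 6 ^ CARD('n) * \<bar>C\<^sub>K\<bar>"
        unfolding abs_of_nonneg[OF CK] abs_of_nonneg[OF CW] by linarith
      then have "3 ^ CARD('n) * C\<^sub>K \<le> 3 ^ CARD('n) * (9 ^ N * \<bar>C\<^sub>W\<bar> + 4 * 6 ^ CARD('n) * \<bar>C\<^sub>K\<bar>)"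
        by (rule mult_left_mono) simp
      also have "\<dots> \<le> A" unfolding A_def by (rule less_imp_le[OF less_add_one])
      also have "A \<le> A * 2" using A by simp
      finally have "3 ^ CARD('n) * C\<^sub>K \<le> A * 2" .
      then have "3 ^ CARD('n) * C\<^sub>K * (C\<^sup>2 * ?r * F_K4 L S D ?Q ?Q ?Q) \<le> A * 2 * (C\<^sup>2 * ?r * F_K4 L S D ?Q ?Q ?Q)"
        by (intro mult_right_mono mult_nonneg_nonneg r0 F_K4_nonneg[OF aux Q Q Q]) auto
      then show ?thesis
        using distant_estimate[OF dom aux CK I J C \<psi>I \<psi>J that] by (simp only: mult_ac)
    qed
    moreover have "cmod (T \<psi>\<^sub>I \<psi>\<^sub>J) \<le> A * C\<^sup>2 * ?r * (1 + \<bar>ln (ec I J)\<bar>) * (F\<^sub>W (smaller_cube I J)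
          + F_K4 L S D (smaller_cube I J) (larger_cube I J) (larger_cube I J))"
      if near: "\<not> rdist I J > 3"
    proof -
      let ?P = "smaller_cube I J" and ?R = "larger_cube I J"
      let ?F = "F_K4 L S D ?P ?R ?R" and ?l = "1 + \<bar>ln (ec I J)\<bar>"
      let ?a = "9 ^ N * C\<^sub>W" and ?b = "4 * 6 ^ CARD('n) * C\<^sub>K"
      have PR: "cube ?P" "cube ?R" using I J by (simp_all add: smaller_cube_def larger_cube_def)
      have add: "T (\<lambda>x. f x + g x) h = T f h + T g h" "T h (\<lambda>x. f x + g x) = T h f + T h g"
        if "f \<in> BMc" "g \<in> BMc" "h \<in> BMc" for f g h
        using T that unfolding operator_pairing_def by blast+
      have scale: "T (\<lambda>x. c * f x) h = c * T f h" "T h (\<lambda>x. c * f x) = c * T h f"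
        if "f \<in> BMc" "h \<in> BMc" for f h c
        using T that unfolding operator_pairing_def by blast+
      have *: "cmod (T \<psi>\<^sub>I \<psi>\<^sub>J) \<le> C\<^sup>2 * ec I J powr (1/2) * (?a * F\<^sub>W ?P + ?b * ?l * ?F)"
      \<comment> \<open>If \<open>J\<close> is the smaller cube, the close estimate is applied to
        the transpose.\<close>
      proof (cases "side J \<le> side I")
        case True
        then have eq: "?P = J" "?R = I" by (simp_all only: smaller_cube_def larger_cube_def if_True)
        have near': "rdist J I \<le> 3" using near by (simp only: rdist_commute[of J I] not_less)
        show ?thesis
          unfolding eq ec_commute[of I J]
          by (rule close_estimate[OF dom' aux CK weak_compactness_flip[OF wc] _ _ J I True C \<psi>J \<psi>I near'])
            (rule add(1) scale(1), assumption+)+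
      next
        case False
        then have eq: "?P = I" "?R = J" by (simp_all only: smaller_cube_def larger_cube_def if_False)
        have IJ: "side I \<le> side J" and near': "rdist I J \<le> 3" using near False by auto
        show ?thesis
          unfolding eq
          by (rule close_estimate[OF dom aux CK wc _ _ I J IJ C \<psi>I \<psi>J near'])
            (rule add(2) scale(2), assumption+)+
      qed
      have nn: "0 \<le> F\<^sub>W ?P" "0 \<le> ?F" "0 \<le> ?a" "0 \<le> ?b" "1 \<le> ?l"
        using FW[OF PR(1)] F_K4_nonneg[OF aux PR(1) PR(2) PR(2)] CK CW by auto
      \<comment> \<open>The logarithmic factor is at least 1, so it may multiply the weak
        compactness term as well.\<close>
      have "?a * F\<^sub>W ?P \<le> (?a + ?b) * ?l * F\<^sub>W ?P"
      proof (intro mult_right_mono nn)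
        have "?a * 1 \<le> (?a + ?b) * ?l" using nn by (intro mult_mono) auto
        then show "?a \<le> (?a + ?b) * ?l" by simp
      qed
      moreover have "?b * ?l * ?F \<le> (?a + ?b) * ?l * ?F"
        using nn by (intro mult_right_mono) auto
      ultimately have "?a * F\<^sub>W ?P + ?b * ?l * ?F
          \<le> (?a + ?b) * ?l * F\<^sub>W ?P + (?a + ?b) * ?l * ?F" by (rule add_mono)
      then have "?a * F\<^sub>W ?P + ?b * ?l * ?F \<le> (?a + ?b) * (?l * (F\<^sub>W ?P + ?F))"
        by (simp only: distrib_left[symmetric] mult.assoc)
      then have "C\<^sup>2 * ec I J powr (1/2) * (?a * F\<^sub>W ?P + ?b * ?l * ?F)
          \<le> C\<^sup>2 * ec I J powr (1/2) * ((?a + ?b) * (?l * (F\<^sub>W ?P + ?F)))"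
        by (rule mult_left_mono) auto
      \<comment> \<open>As \<open>rdist I J\<close> is at most 3, dividing by its power costs at
        most \<open>3 ^ CARD('n)\<close>.\<close>
      also have "\<dots> \<le> C\<^sup>2 * (3 ^ CARD('n) * ?r) * ((?a + ?b) * (?l * (F\<^sub>W ?P + ?F)))"
      proof (intro mult_right_mono mult_left_mono)
        have "rdist I J ^ CARD('n) \<le> 3 ^ CARD('n)" using near r1 by (intro power_mono) auto
        then have "ec I J powr (1/2) * rdist I J ^ CARD('n) \<le> ec I J powr (1/2) * 3 ^ CARD('n)"
          by (rule mult_left_mono) simp
        then show "ec I J powr (1/2) \<le> 3 ^ CARD('n) * ?r"
          using r1 by (simp add: pos_le_divide_eq mult.commute)
      qed (use nn in auto)
      also have "\<dots> = 3 ^ CARD('n) * (?a + ?b) * (C\<^sup>2 * ?r * (?l * (F\<^sub>W ?P + ?F)))"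
        by (simp only: mult_ac)
      also have "\<dots> \<le> A * (C\<^sup>2 * ?r * (?l * (F\<^sub>W ?P + ?F)))"
      proof (rule mult_right_mono)
        show "3 ^ CARD('n) * (?a + ?b) \<le> A" using CK CW by (simp add: A_def)
        show "0 \<le> C\<^sup>2 * ?r * (?l * (F\<^sub>W ?P + ?F))"
          by (intro mult_nonneg_nonneg add_nonneg_nonneg r0 nn order_trans[OF zero_le_one nn(5)]) simp
      qed
      finally show ?thesis using * by (simp only: mult.assoc)
    qed
    ultimately show "let F\<^sub>K = F_K4 L S D;
               \<theta> = (if rdist I J > 3 then 0 else 1 :: nat);
               F = (if rdist I J > 3
                    then F\<^sub>K (joint_cube I J) (joint_cube I J) (joint_cube I J)
                    else F\<^sub>W (smaller_cube I J)
                         + F\<^sub>K (smaller_cube I J) (larger_cube I J) (larger_cube I J))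
           in cmod (T \<psi>\<^sub>I \<psi>\<^sub>J)
                \<le> A * C\<^sup>2 * (ec I J powr (1/2) / rdist I J ^ CARD('n))
                    * (1 + \<bar>ln (ec I J)\<bar> ^ \<theta>) * F"
      unfolding Let_def by (cases "rdist I J > 3") (simp_all only: if_True if_False power_0 power_one_right one_add_one simp_thms)
  qed
qed simp_all

end
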